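(* Let $G$ be a connected regular graph with an even number of vertices satisfying the odd cycle condition. Then the edge ring $\Bbbk[G]$ is pseudo-Gorenstein.
   Context: All graphs are finite, with no loops and no multiple edges. $\Bbbk$ is an algebraically closed field of characteristic $0$. For a graph $G$ on $[d]=\{1,\ldots,d\}$, the edge ring is $\Bbbk[G]=\Bbbk[t_it_j:\{i,j\}\in E(G)]\subset\Bbbk[t_1,\ldots,t_d]$, graded by $\deg(t_it_j)=1$ for every edge. A graph is regular if all its vertices have the same degree. A connected graph $G$ satisfies the odd cycle condition if for each pair of odd cycles $C$ and $C'$ of $G$ with no common vertex there is an edge $\{v,v'\}\in E(G)$ with $v\in V(C)$ and $v'\in V(C')$. (For connected $G$ this is equivalent to normality of $\Bbbk[G]$, and it implies that $\Bbbk[G]$ is Cohen--Macaulay.) For a Cohen--Macaulay standard graded domain $R=\bigoplus_{k\ge 0}R_k$ with $R_0=\Bbbk$ and Krull dimension $D$, write $\sum_{k\ge0}(\dim_\Bbbk R_k)t^k=\dfrac{h_0+\cdots+h_st^s}{(1-t)^D}$ with $h_s\ne0$. $R$ is pseudo-Gorenstein if $h_s=1$. *)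

theory Defs
  imports
    "HOL-Library.Poly_Mapping"
    "HOL-Library.Extended_Nat"
    "HOL-Computational_Algebra.Computational_Algebra"
    "HOL-Algebra.Ideal"
    "HOL-Algebra.Generated_Rings"
    "HOL-Algebra.Algebraic_Closure_Type"
begin

section \<open>Graphs\<close>

text \<open>A graph on the vertex set $[d]$ is given by its set of edges, each edge being a
  two-element subset of $[d]$; this excludes loops and multiple edges.\<close>

type_synonym edges = "nat set set"

definition graph_on :: "nat \<Rightarrow> edges \<Rightarrow> bool" where
  "graph_on d E \<longleftrightarrow> (\<forall>e\<in>E. e \<subseteq> {1..d} \<and> card e = 2)"

definition connected_graph :: "nat \<Rightarrow> edges \<Rightarrow> bool" where
  "connected_graph d E \<longleftrightarrow>
     d \<ge> 1 \<and> (\<forall>u\<in>{1..d}. \<forall>v\<in>{1..d}. (u, v) \<in> {(x, y). {x, y} \<in> E}\<^sup>*)"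

definition vertex_degree :: "edges \<Rightarrow> nat \<Rightarrow> nat" where
  "vertex_degree E v = card {e \<in> E. v \<in> e}"

definition regular_graph :: "nat \<Rightarrow> edges \<Rightarrow> bool" where
  "regular_graph d E \<longleftrightarrow> (\<exists>r. \<forall>v\<in>{1..d}. vertex_degree E v = r)"

text \<open>A cycle is represented by the list of its distinct vertices in cyclic order; its
  length is the length of the list.\<close>

definition graph_cycle :: "edges \<Rightarrow> nat list \<Rightarrow> bool" where
  "graph_cycle E vs \<longleftrightarrow>
     length vs \<ge> 3 \<and> distinct vs \<and>
     (\<forall>i<length vs. {vs ! i, vs ! ((i + 1) mod length vs)} \<in> E)"

definition odd_cycle :: "edges \<Rightarrow> nat list \<Rightarrow> bool" where
  "odd_cycle E vs \<longleftrightarrow> graph_cycle E vs \<and> odd (length vs)"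

definition odd_cycle_condition :: "edges \<Rightarrow> bool" where
  "odd_cycle_condition E \<longleftrightarrow>
     (\<forall>C C'. odd_cycle E C \<and> odd_cycle E C' \<and> set C \<inter> set C' = {} \<longrightarrow>
        (\<exists>v\<in>set C. \<exists>v'\<in>set C'. {v, v'} \<in> E))"


section \<open>Edge rings\<close>

text \<open>Polynomials over \<open>'k\<close> in the variables $t_0, t_1, \ldots$: finitely supported
  functions from exponent vectors to coefficients, with the convolution product. The edge
  ring of a graph on $[d]$ only involves $t_1, \ldots, t_d$.\<close>

type_synonym 'k mpoly = "(nat \<Rightarrow>\<^sub>0 nat) \<Rightarrow>\<^sub>0 'k"

definition mpoly_const :: "'k::field \<Rightarrow> 'k mpoly" where
  "mpoly_const c = Poly_Mapping.single 0 c"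

definition mpoly_var :: "nat \<Rightarrow> 'k::field mpoly" where
  "mpoly_var i = Poly_Mapping.single (Poly_Mapping.single i 1) 1"

definition mpoly_scale :: "'k::field \<Rightarrow> 'k mpoly \<Rightarrow> 'k mpoly" where
  "mpoly_scale c p = mpoly_const c * p"

global_interpretation mpoly: vector_space "mpoly_scale :: 'k::field \<Rightarrow> 'k mpoly \<Rightarrow> 'k mpoly"
  by unfold_locales
    (simp_all add: mpoly_scale_def mpoly_const_def algebra_simps single_add mult_single
       flip: mult.assoc)

definition edge_monomial :: "nat set \<Rightarrow> 'k::field mpoly" where
  "edge_monomial e = (\<Prod>i\<in>e. mpoly_var i)"

text \<open>The edge ring, as a subring of the polynomial ring: the subring generated by the
  constants and the monomials $t_i t_j$ for the edges $\{i,j\}$.\<close>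

definition edge_ring :: "edges \<Rightarrow> ('k::field mpoly) ring" where
  "edge_ring E = ring_of_type_algebra
     \<lparr>carrier := generate_ring ring_of_type_algebra (range mpoly_const \<union> edge_monomial ` E)\<rparr>"

text \<open>The grading with $\deg(t_i t_j) = 1$: the component of degree \<open>n\<close> is spanned by the
  products of \<open>n\<close> (not necessarily distinct) generators.\<close>

definition edge_ring_component :: "edges \<Rightarrow> nat \<Rightarrow> 'k::field mpoly set" where
  "edge_ring_component E n =
     mpoly.span {prod_list (map edge_monomial es) | es. set es \<subseteq> E \<and> length es = n}"


section \<open>Krull dimension and pseudo-Gorenstein rings\<close>

text \<open>The supremum of the lengths $n$ of chains $P_0 \subset \cdots \subset P_n$ of prime
  ideals.\<close>

definition krull_dim :: "('a, 'b) ring_scheme \<Rightarrow> enat" where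
  "krull_dim R = Sup {enat n | n. \<exists>P :: nat \<Rightarrow> 'a set.
     (\<forall>i\<le>n. primeideal (P i) R) \<and> (\<forall>i<n. P i \<subset> P (Suc i))}"

text \<open>Here \<open>R\<close> is a graded algebra over a field acting by \<open>scale\<close>, with components \<open>A n\<close>,
  and $h = h_0 + \cdots + h_s t^s$ is the numerator of its Hilbert series written with
  denominator $(1-t)^D$, where $D$ is the (finite) Krull dimension.\<close>

definition is_h_polynomial ::
  "('k::field \<Rightarrow> 'a::ab_group_add \<Rightarrow> 'a) \<Rightarrow> 'a ring \<Rightarrow> (nat \<Rightarrow> 'a set) \<Rightarrow> int poly \<Rightarrow> bool" where
  "is_h_polynomial scale R A h \<longleftrightarrow>
     (\<exists>D. krull_dim R = enat D \<and>
        fps_of_poly h = (1 - fps_X) ^ D * Abs_fps (\<lambda>n. int (vector_space.dim scale (A n))))"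

text \<open>The notion is used for Cohen--Macaulay standard graded domains \<open>R\<close>. As in the
  usual definition, these are standing assumptions on \<open>R\<close> and not clauses of the condition
  $h_s = 1$. The polynomial $h$ is unique if it exists.\<close>

definition pseudo_Gorenstein ::
  "('k::field \<Rightarrow> 'a::ab_group_add \<Rightarrow> 'a) \<Rightarrow> 'a ring \<Rightarrow> (nat \<Rightarrow> 'a set) \<Rightarrow> bool" where
  "pseudo_Gorenstein scale R A \<longleftrightarrow> (\<exists>h. is_h_polynomial scale R A h \<and> lead_coeff h = 1)"

end

(* By the odd cycle condition, the exponents of the monomials in the edge ring are all points of the
   cone spanned by the edge vectors that lie in the lattice L of integral vectors with even
   coordinate sum. Triangulate this cone by means of generic weights w on the edges: the pieces are
   the cones over the bases B that are optimal for the linear program of minimising the weight.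
   Pushing the points of the cone by an infinitesimal amount in a generic interior direction p makes
   the pieces half-open and disjoint, and pushing them in direction -p does the same for the interior
   of the cone. The lattice points of a piece are box points plus nonnegative combinations of B, and
   z -> (sum of B) - z exchanges the boxes for p and -p. Hence, with D the rank of the edge vectors,
   (1-t)^D times the Hilbert series of the cone is a polynomial h, and (1-t)^D times that of the
   interior is t^D h(1/t). For a regular graph on d = 2m vertices the vector (1,...,1) is an
   interior lattice point of degree m, and every interior lattice point has all coordinates >= 1, so
   t^D h(1/t) = t^m + higher terms, and the leading coefficient of h is 1.

   The Krull dimension is D: a chain of kernels of coordinate projections gives the lower bound, and
   comparing the growth of the Hilbert function with the number of monomials in elements chosen along
   a chain of primes gives the upper bound. *)

theory Submission
  imports Defs "HOL-Analysis.Finite_Function_Topology"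
begin

section \<open>Generic triangulations of cones\<close>

text \<open>The leading coefficient of \<open>h\<close> is the number of interior lattice points of
  least degree. Algebraically this reflects that the canonical module of a normal semigroup ring is
  spanned by the interior monomials; only the numerical shadow of that fact is proved here. Three
  points shape the argument. All generators have degree 1, which gives every piece the same
  denominator and also keeps the linear program bounded. Finally, the numerator is normalised by the
  Krull dimension of the ring: an exponent too large by k would multiply \<open>h\<close> by the
  k-th power of 1-t and its leading coefficient by the k-th power of -1, so the rank of the edge
  vectors really has to be identified with the Krull dimension.\<close>

definition fcone :: "'v::real_vector set \<Rightarrow> 'v set" where
  "fcone A = {\<Sum>a\<in>A. c a *\<^sub>R a | c. \<forall>a\<in>A. 0 \<le> c a}"

text \<open>For finite \<open>A\<close> this is the relative interior of
  \<open>fcone A\<close>.\<close>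

definition ocone :: "'v::real_vector set \<Rightarrow> 'v set" where
  "ocone A = {\<Sum>a\<in>A. c a *\<^sub>R a | c. \<forall>a\<in>A. 0 < c a}"

lemma fconeI: "(\<And>a. a \<in> A \<Longrightarrow> 0 \<le> c a) \<Longrightarrow> (\<Sum>a\<in>A. c a *\<^sub>R a) \<in> fcone A"
  by (auto simp: fcone_def)

lemma ocone_subset_fcone: "ocone A \<subseteq> fcone A"
  unfolding ocone_def fcone_def using less_imp_le by blast

lemma fcone_subset_span: "fcone A \<subseteq> span A"
  unfolding fcone_def by (clarify, intro span_sum span_scale span_base)

lemma fcone_add: "x \<in> fcone A \<Longrightarrow> y \<in> fcone A \<Longrightarrow> x + y \<in> fcone A"
proof -
  assume "x \<in> fcone A" "y \<in> fcone A"
  then obtain c e where c: "\<forall>a\<in>A. 0 \<le> c a" "x = (\<Sum>a\<in>A. c a *\<^sub>R a)"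
    and e: "\<forall>a\<in>A. 0 \<le> e a" "y = (\<Sum>a\<in>A. e a *\<^sub>R a)" by (auto simp: fcone_def)
  then have "x + y = (\<Sum>a\<in>A. (c a + e a) *\<^sub>R a)"
    by (simp add: scaleR_add_left sum.distrib)
  then show ?thesis using c e fconeI[of A "\<lambda>a. c a + e a"] by auto
qed

lemma fcone_scale: "x \<in> fcone A \<Longrightarrow> 0 \<le> r \<Longrightarrow> r *\<^sub>R x \<in> fcone A"
proof -
  assume "x \<in> fcone A" "0 \<le> r"
  then obtain c where c: "\<forall>a\<in>A. 0 \<le> c a" "x = (\<Sum>a\<in>A. c a *\<^sub>R a)"
    by (auto simp: fcone_def)
  then have "r *\<^sub>R x = (\<Sum>a\<in>A. (r * c a) *\<^sub>R a)"
    by (simp add: scaleR_sum_right)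
  then show ?thesis using c \<open>0 \<le> r\<close> fconeI[of A "\<lambda>a. r * c a"] by auto
qed

lemma fcone_mono:
  assumes "finite A" "B \<subseteq> A" shows "fcone B \<subseteq> fcone A"
proof
  fix x assume "x \<in> fcone B"
  then obtain c where c: "\<forall>a\<in>B. 0 \<le> c a" "x = (\<Sum>a\<in>B. c a *\<^sub>R a)"
    by (auto simp: fcone_def)
  have "x = (\<Sum>a\<in>A. (if a \<in> B then c a else 0) *\<^sub>R a)"
    using assms c by (auto intro!: sum.mono_neutral_cong_left)
  then show "x \<in> fcone A" using c(1) fconeI[of A "\<lambda>a. if a \<in> B then c a else 0"] by auto
qed

section \<open>Caratheodory's theorem and generic choices\<close>

text \<open>A positive representation with the fewest terms has independent support: otherwise a
  multiple of a linear dependence could be subtracted until some coefficient vanishes.\<close>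

lemma fcone_caratheodory:
  assumes "finite A" "y \<in> fcone A"
  obtains T c where "T \<subseteq> A" "independent T" "\<forall>a\<in>T. 0 < c a" "y = (\<Sum>a\<in>T. c a *\<^sub>R a)"
proof -
  define P where "P T \<longleftrightarrow> T \<subseteq> A \<and> (\<exists>c. (\<forall>a\<in>T. 0 < c a) \<and> y = (\<Sum>a\<in>T. c a *\<^sub>R a))" for T
  have drop: "P {a\<in>T. 0 < c a}" if "T \<subseteq> A" "\<forall>a\<in>T. 0 \<le> c a" "y = (\<Sum>a\<in>T. c a *\<^sub>R a)" for T c
  proof -
    have "finite T" using that(1) assms(1) finite_subset by blast
    then have "y = (\<Sum>a\<in>{a\<in>T. 0 < c a}. c a *\<^sub>R a)"
      unfolding that(3) using that(2) by (intro sum.mono_neutral_right) force+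
    then show ?thesis using that(1) unfolding P_def by blast
  qed
  obtain c where "\<forall>a\<in>A. 0 \<le> c a" "y = (\<Sum>a\<in>A. c a *\<^sub>R a)"
    using assms(2) by (auto simp: fcone_def)
  then have "\<exists>T. P T" using drop by blast
  then obtain T where T: "P T" and least: "\<And>T'. P T' \<Longrightarrow> card T \<le> card T'"
    using exists_least_iff[of "\<lambda>n. \<exists>T. P T \<and> card T = n"] by (metis not_less)
  obtain c where c: "\<forall>a\<in>T. 0 < c a" "y = (\<Sum>a\<in>T. c a *\<^sub>R a)" and TA: "T \<subseteq> A"
    using T unfolding P_def by blast
  have fT: "finite T" using TA assms(1) finite_subset by blast
  have "independent T"
  proof (rule ccontr)
    assume "\<not> independent T"
    then obtain u0 v where v: "v \<in> T" "u0 v \<noteq> 0" "(\<Sum>v\<in>T. u0 v *\<^sub>R v) = 0"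
      using dependent_finite[OF fT] by blast
    \<comment> \<open>The sign makes the coefficient at \<open>v\<close> positive, so the set
      \<open>R\<close> of ratios is nonempty.\<close>
    define u where "u a = sgn (u0 v) * u0 a" for a
    have u: "0 < u v" "(\<Sum>v\<in>T. u v *\<^sub>R v) = 0"
      using v scaleR_sum_right[of "sgn (u0 v)" "\<lambda>a. u0 a *\<^sub>R a" T]
      by (auto simp: u_def sgn_if mult_less_0_iff)
    define R where "R = (\<lambda>a. c a / u a) ` {a\<in>T. 0 < u a}"
    have R: "finite R" "R \<noteq> {}" using fT v u(1) by (auto simp: R_def)
    \<comment> \<open>The largest multiple of the dependence that keeps all coefficients
      nonnegative; the coefficient at the minimising \<open>v0\<close> drops to zero.\<close>
    define \<tau> where "\<tau> = Min R"
    obtain v0 where v0: "v0 \<in> T" "0 < u v0" "\<tau> = c v0 / u v0"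
      using Min_in[OF R] by (auto simp: R_def \<tau>_def)
    have "0 < \<tau>" using v0 c by auto
    have ge: "0 \<le> c a - \<tau> * u a" if "a \<in> T" for a
    proof (cases "0 < u a")
      case True
      then have "\<tau> \<le> c a / u a" using R(1) that by (auto simp: \<tau>_def R_def)
      then show ?thesis using True by (simp add: field_simps)
    next
      case False
      then have "\<tau> * u a \<le> 0" using \<open>0 < \<tau>\<close> by (simp add: mult_nonneg_nonpos)
      then show ?thesis using c(1) that by force
    qed
    have "(\<Sum>a\<in>T. (c a - \<tau> * u a) *\<^sub>R a) = y - \<tau> *\<^sub>R (\<Sum>a\<in>T. u a *\<^sub>R a)"
      by (simp add: c(2) scaleR_diff_left sum_subtractf scaleR_sum_right)
    then have "P {a\<in>T. 0 < c a - \<tau> * u a}"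
      using drop[OF TA, of "\<lambda>a. c a - \<tau> * u a"] ge u(2) by simp
    moreover have "v0 \<notin> {a\<in>T. 0 < c a - \<tau> * u a}" using v0 by auto
    then have "{a\<in>T. 0 < c a - \<tau> * u a} \<subset> T" using v0(1) by blast
    ultimately show False using least psubset_card_mono[OF fT] by (meson leD)
  qed
  then show thesis using that c TA by blast
qed

text \<open>On the moment curve, with weights \<open>s ^ idx a\<close>, each nonzero linear form
  becomes a nonzero polynomial in \<open>s\<close>. Finitely many polynomials have finitely many
  roots, so some positive \<open>s\<close> avoids them all.\<close>

lemma generic_weights:
  fixes \<Phi> :: "('a \<Rightarrow> real) set"
  assumes "finite A" "finite \<Phi>" "\<And>f. f \<in> \<Phi> \<Longrightarrow> \<exists>a\<in>A. f a \<noteq> 0"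
  obtains \<alpha> :: "'a \<Rightarrow> real" where "\<And>a. a \<in> A \<Longrightarrow> 0 < \<alpha> a"
    "\<And>f. f \<in> \<Phi> \<Longrightarrow> (\<Sum>a\<in>A. f a * \<alpha> a) \<noteq> 0"
proof -
  obtain idx :: "'a \<Rightarrow> nat" where idx: "inj_on idx A"
    using finite_imp_inj_to_nat_seg[OF assms(1)] by blast
  define p where "p f = (\<Sum>a\<in>A. monom (f a) (idx a))" for f :: "'a \<Rightarrow> real"
  have "p f \<noteq> 0" if f: "f \<in> \<Phi>" for f
  proof -
    obtain a where a: "a \<in> A" "f a \<noteq> 0" using assms(3)[OF f] by blast
    have "coeff (p f) (idx a) = (\<Sum>b\<in>A. if b = a then f b else 0)"
      unfolding p_def coeff_sum by (intro sum.cong) (use idx a in \<open>auto simp: inj_on_def\<close>)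
    then show ?thesis using a assms(1) by auto
  qed
  then have "finite (\<Union>f\<in>\<Phi>. {s. poly (p f) s = 0})"
    using assms(2) by (auto intro: poly_roots_finite)
  then have "infinite ({0<..} - (\<Union>f\<in>\<Phi>. {s. poly (p f) s = 0}))"
    using Diff_infinite_finite infinite_Ioi by blast
  then have "{0<..} - (\<Union>f\<in>\<Phi>. {s. poly (p f) s = 0}) \<noteq> {}"
    by (rule infinite_imp_nonempty)
  then obtain s where s: "0 < s" "\<And>f. f \<in> \<Phi> \<Longrightarrow> poly (p f) s \<noteq> 0"
    by auto
  show thesis
    by (rule that[of "\<lambda>a. s ^ idx a"]) (use s in \<open>auto simp: p_def poly_sum poly_monom\<close>)
qed

lemma representation_unique:
  assumes "independent B" "finite B" "v = (\<Sum>b\<in>B. f b *\<^sub>R b)" "b \<in> B"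
  shows "representation B v b = f b"
proof -
  have "v \<in> span B" unfolding assms(3) by (intro span_sum span_scale span_base)
  then have "(\<Sum>b\<in>B. representation B v b *\<^sub>R b) = v"
    using real_vector.sum_representation_eq[OF assms(1) _ assms(2) order_refl] by blast
  then have "(\<Sum>b\<in>B. (representation B v b - f b) *\<^sub>R b) = 0"
    by (simp add: scaleR_diff_left sum_subtractf assms(3)[symmetric])
  from independentD[OF assms(1,2) order_refl this assms(4)] show ?thesis by simp
qed

section \<open>Bases among the generators\<close>

text \<open>Degree 1 puts the generators on an affine hyperplane missing the origin, so the
  coordinates of a generator in any basis sum to 1.\<close>

locale cone_generators =
  fixes A :: "'v::real_vector set" and deg :: "'v \<Rightarrow> real"
  assumes finite_A: "finite A" and linear_deg: "linear deg" and deg_A: "a \<in> A \<Longrightarrow> deg a = 1"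
begin

abbreviation "rep \<equiv> (representation :: 'v set \<Rightarrow> _)"

definition bases :: "'v set set" where
  "bases = {B. B \<subseteq> A \<and> independent B \<and> A \<subseteq> span B}"

lemma bases_subset: "B \<in> bases \<Longrightarrow> B \<subseteq> A"
  and bases_independent: "B \<in> bases \<Longrightarrow> independent B"
  by (auto simp: bases_def)

lemma bases_finite: "B \<in> bases \<Longrightarrow> finite B"
  using finite_A bases_subset finite_subset by metis

lemma bases_span: "B \<in> bases \<Longrightarrow> span B = span A"
  unfolding bases_def by (intro equalityI span_mono span_minimal) auto

lemma bases_card: "B \<in> bases \<Longrightarrow> card B = dim A"
  by (metis bases_independent bases_span dim_eq_card)

lemma finite_bases: "finite bases"
  by (rule finite_subset[of _ "Pow A"]) (auto simp: bases_def finite_A)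

lemma rep_sum: "B \<in> bases \<Longrightarrow> x \<in> span A \<Longrightarrow> (\<Sum>b\<in>B. rep B x b *\<^sub>R b) = x"
  using real_vector.sum_representation_eq[OF _ _ _ order_refl]
  by (metis bases_finite bases_independent bases_span)

lemma rep_add: "B \<in> bases \<Longrightarrow> x \<in> span A \<Longrightarrow> y \<in> span A \<Longrightarrow> rep B (x + y) b = rep B x b + rep B y b"
  by (simp add: bases_independent bases_span real_vector.representation_add)

lemma rep_diff: "B \<in> bases \<Longrightarrow> x \<in> span A \<Longrightarrow> y \<in> span A \<Longrightarrow> rep B (x - y) b = rep B x b - rep B y b"
  by (simp add: bases_independent bases_span real_vector.representation_diff)

lemma rep_neg: "B \<in> bases \<Longrightarrow> x \<in> span A \<Longrightarrow> rep B (- x) b = - rep B x b"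
  by (simp add: bases_independent bases_span real_vector.representation_neg)

lemma rep_scale: "B \<in> bases \<Longrightarrow> x \<in> span A \<Longrightarrow> rep B (r *\<^sub>R x) b = r * rep B x b"
  by (simp add: bases_independent bases_span real_vector.representation_scale)

lemma rep_combination:
  assumes "B \<in> bases" "\<And>i. i \<in> I \<Longrightarrow> g i \<in> span A"
  shows "rep B (\<Sum>i\<in>I. f i *\<^sub>R g i) b = (\<Sum>i\<in>I. f i * rep B (g i) b)"
  using assms by (subst real_vector.representation_sum)
    (auto simp: bases_independent bases_span rep_scale span_scale)

lemma rep_basis: "B \<in> bases \<Longrightarrow> b \<in> B \<Longrightarrow> rep B b b' = (if b' = b then 1 else 0)"
  by (simp add: bases_independent real_vector.representation_basis)

lemma deg_rep: "B \<in> bases \<Longrightarrow> x \<in> span A \<Longrightarrow> deg x = (\<Sum>b\<in>B. rep B x b)"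
proof -
  assume B: "B \<in> bases" and x: "x \<in> span A"
  have "deg x = deg (\<Sum>b\<in>B. rep B x b *\<^sub>R b)" using rep_sum[OF B x] by simp
  also have "\<dots> = (\<Sum>b\<in>B. rep B x b * deg b)"
    by (simp add: linear_sum[OF linear_deg] linear_cmul[OF linear_deg])
  also have "\<dots> = (\<Sum>b\<in>B. rep B x b)"
    using bases_subset[OF B] by (intro sum.cong) (auto simp: deg_A)
  finally show ?thesis .
qed

lemma pivot:
  assumes B: "B \<in> bases" and b: "b \<in> B" and a: "a \<in> A - B" and nz: "rep B a b \<noteq> 0"
  shows "insert a (B - {b}) \<in> bases"
proof -
  have aB: "a \<in> span B" using a bases_span[OF B] span_base by auto
  have notin: "a \<notin> span (B - {b})"
  proof
    assume "a \<in> span (B - {b})"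
    then have "rep B a = rep (B - {b}) a"
      by (intro real_vector.representation_extend) (auto simp: bases_independent B)
    then show False using nz real_vector.representation_ne_zero[of "B - {b}" a b] by auto
  qed
  have "b \<in> span (insert a (B - {b}))"
    by (rule in_span_insert) (use aB notin b in \<open>auto simp: insert_absorb\<close>)
  then have "B \<subseteq> span (insert a (B - {b}))"
    by (metis Diff_iff insertCI insertE insert_Diff span_base b subsetI)
  then have "A \<subseteq> span (insert a (B - {b}))"
    by (metis B bases_span span_minimal span_superset subset_trans subspace_span)
  moreover have "independent (insert a (B - {b}))"
    using notin bases_independent[OF B] independent_insertI independent_mono by (metis Diff_subset)
  ultimately show ?thesis using a bases_subset[OF B] by (auto simp: bases_def)
qed

definition positive :: "'v set \<Rightarrow> 'v \<Rightarrow> bool" where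
  "positive B y \<longleftrightarrow> (\<forall>b\<in>B. 0 < rep B y b)"

text \<open>Such a \<open>y\<close> avoids every hyperplane of \<open>span A\<close> spanned by a
  basis with one element removed. In terms of linear programming, no basic solution for
  \<open>y\<close> is degenerate.\<close>

definition generic :: "'v \<Rightarrow> bool" where
  "generic y \<longleftrightarrow> y \<in> span A \<and> (\<forall>B\<in>bases. \<forall>b\<in>B. rep B y b \<noteq> 0)"

text \<open>Extend the independent support given by Caratheodory to a basis. The added elements get
  coordinate 0, which genericity forbids, so the support already was the basis.\<close>

lemma ex_positive_basis:
  assumes "y \<in> fcone A" "generic y"
  shows "\<exists>B\<in>bases. positive B y"
proof -
  obtain T c where T: "T \<subseteq> A" "independent T" "\<forall>a\<in>T. 0 < c a" "y = (\<Sum>a\<in>T. c a *\<^sub>R a)"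
    using fcone_caratheodory[OF finite_A assms(1)] by blast
  obtain B where B: "T \<subseteq> B" "B \<subseteq> A" "independent B" "A \<subseteq> span B"
    using maximal_independent_subset_extend[OF T(1,2)] by blast
  have Bb: "B \<in> bases" using B by (simp add: bases_def)
  have "y = (\<Sum>a\<in>B. (if a \<in> T then c a else 0) *\<^sub>R a)"
    unfolding T(4) using B(1) bases_finite[OF Bb] by (auto intro!: sum.mono_neutral_cong_left)
  then have r: "rep B y b = (if b \<in> T then c b else 0)" if "b \<in> B" for b
    using representation_unique[of B y "\<lambda>a. if a \<in> T then c a else 0" b] B(3) bases_finite[OF Bb] that
    by blast
  have "positive B y"
    using r assms(2) T(3) Bb unfolding positive_def generic_def by metis
  then show ?thesis using Bb by blast
qed

end

section \<open>Regular triangulations by linear programming\<close>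

text \<open>Lift each generator \<open>a\<close> to height \<open>w a\<close>. The assumption says
  that the lift of \<open>a\<close> never lies on the hyperplane spanned by the lifts of a basis not
  containing \<open>a\<close>; this excludes ties in the simplex method.\<close>

locale cone_weights = cone_generators A deg
  for A :: "'v::real_vector set" and deg :: "'v \<Rightarrow> real" +
  fixes w :: "'v \<Rightarrow> real"
  assumes w_generic: "B \<in> bases \<Longrightarrow> a \<in> A - B \<Longrightarrow> (\<Sum>b\<in>B. rep B a b * w b) \<noteq> w a"
begin

text \<open>As a function of \<open>y\<close> this is the linear functional on \<open>span A\<close>
  agreeing with \<open>w\<close> on \<open>B\<close>, that is, the dual solution belonging to
  \<open>B\<close>. For fixed \<open>y\<close> it is the objective value of the basic solution
  \<open>B\<close>.\<close>

definition cost :: "'v set \<Rightarrow> 'v \<Rightarrow> real" where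
  "cost B y = (\<Sum>b\<in>B. rep B y b * w b)"

text \<open>This is strict dual feasibility. It does not involve the right-hand side
  \<open>y\<close>, so a single family of bases serves all points of the cone; these are the
  simplices of the regular triangulation induced by \<open>w\<close>.\<close>

definition optimal_bases :: "'v set set" where
  "optimal_bases = {B \<in> bases. \<forall>a\<in>A - B. cost B a < w a}"

lemma cost_combination:
  assumes "B \<in> bases" "\<And>i. i \<in> I \<Longrightarrow> g i \<in> span A"
  shows "cost B (\<Sum>i\<in>I. f i *\<^sub>R g i) = (\<Sum>i\<in>I. f i * cost B (g i))"
proof -
  have "rep B (\<Sum>i\<in>I. f i *\<^sub>R g i) b = (\<Sum>i\<in>I. f i * rep B (g i) b)" for b
    by (rule rep_combination) (use assms in auto)
  then show ?thesis
    by (simp add: cost_def sum_distrib_right sum_distrib_left mult.assoc sum.swap[of _ I B])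
qed

lemma cost_basis: "B \<in> bases \<Longrightarrow> b \<in> B \<Longrightarrow> cost B b = w b"
  unfolding cost_def using bases_finite[of B] by (simp add: rep_basis mult_delta_left)

text \<open>Weak duality: for an optimal basis \<open>B\<close>, the linear functional \<open>cost B\<close> is bounded
  by \<open>w\<close> on \<open>A\<close>, with equality exactly on \<open>B\<close>.\<close>

lemma cost_optimal:
  assumes B: "B \<in> optimal_bases" and C: "C \<in> bases" and y: "y \<in> span A" "positive C y"
  shows "cost B y \<le> cost C y" and "\<not> C \<subseteq> B \<Longrightarrow> cost B y < cost C y"
proof -
  have Bb: "B \<in> bases" using B by (simp add: optimal_bases_def)
  have le: "cost B c \<le> w c" if "c \<in> C" for c
    using B bases_subset[OF C] that cost_basis[OF Bb]
      by (cases "c \<in> B") (auto simp: optimal_bases_def less_imp_le)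
  have eq: "cost B y = (\<Sum>c\<in>C. rep C y c * cost B c)"
    using cost_combination[OF Bb, of C "\<lambda>c. c" "rep C y"] rep_sum[OF C y(1)] bases_subset[OF C]
    by (auto simp: span_base subset_iff)
  show "cost B y \<le> cost C y"
    unfolding eq cost_def[of C] using y(2) le
    by (intro sum_mono mult_left_mono) (auto simp: positive_def less_imp_le)
  assume "\<not> C \<subseteq> B"
  then obtain c where c: "c \<in> C" "c \<notin> B" by blast
  have "rep C y c * cost B c < rep C y c * w c"
    using c B bases_subset[OF C] y(2) by (auto simp: optimal_bases_def positive_def)
  then show "cost B y < cost C y"
    unfolding eq cost_def[of C] using y(2) le bases_finite[OF C] c(1)
    by (intro sum_strict_mono_ex1) (auto simp: positive_def less_imp_le mult_left_mono)
qed

text \<open>Weak duality in both directions makes the two costs equal, and its strict form then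
  leaves no element of one basis outside the other.\<close>

lemma optimal_basis_unique:
  assumes "B \<in> optimal_bases" "C \<in> optimal_bases" "y \<in> span A" "positive B y" "positive C y"
  shows "B = C"
proof -
  have b: "B \<in> bases" "C \<in> bases" using assms by (auto simp: optimal_bases_def)
  have "C \<subseteq> B" "B \<subseteq> C"
    using cost_optimal(1)[OF assms(1) b(2) assms(3,5)] cost_optimal(2)[OF assms(1) b(2) assms(3,5)]
      cost_optimal(1)[OF assms(2) b(1) assms(3,4)] cost_optimal(2)[OF assms(2) b(1) assms(3,4)]
    by linarith+
  then show ?thesis by blast
qed

text \<open>One pivot of the simplex method: \<open>a\<close> enters the basis because its reduced
  cost is negative, and the ratio test selects the leaving element \<open>b0\<close>.\<close>

lemma improve:
  assumes B: "B \<in> bases" "positive B y" and y: "generic y" and a: "a \<in> A - B" "w a < cost B a"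
  shows "\<exists>C\<in>bases. positive C y \<and> cost C y < cost B y"
proof -
  have yA: "y \<in> span A" using y by (simp add: generic_def)
  have aA: "a \<in> span A" using a by (simp add: span_base)
  have fB: "finite B" by (rule bases_finite[OF B(1)])
  define r where "r = rep B a"
  define c where "c = rep B y"
  \<comment> \<open>Because all generators have degree 1, some coordinate of \<open>a\<close> is
    positive. The ratio test thus has a candidate, and the objective cannot decrease along an
    unbounded ray.\<close>
  have "(\<Sum>b\<in>B. r b) = 1" using deg_rep[OF B(1) aA] deg_A[of a] a by (simp add: r_def)
  then obtain b1 where b1: "b1 \<in> B" "0 < r b1"
    by (metis not_less sum_nonpos zero_less_one)
  define R where "R = (\<lambda>b. c b / r b) ` {b\<in>B. 0 < r b}"
  have R: "finite R" "R \<noteq> {}" using fB b1 by (auto simp: R_def)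
  define \<tau> where "\<tau> = Min R"
  obtain b0 where b0: "b0 \<in> B" "0 < r b0" "\<tau> = c b0 / r b0"
    using Min_in[OF R] by (auto simp: R_def \<tau>_def)
  have cpos: "0 < c b" if "b \<in> B" for b using that B(2) by (simp add: positive_def c_def)
  have tau: "0 < \<tau>" using b0 cpos by auto
  have ge: "0 \<le> c b - \<tau> * r b" if "b \<in> B" for b
  proof (cases "0 < r b")
    case True
    then have "\<tau> \<le> c b / r b" using R(1) that by (auto simp: \<tau>_def R_def)
    then show ?thesis using True by (simp add: field_simps)
  next
    case False
    then have "\<tau> * r b \<le> 0" using tau by (simp add: mult_nonneg_nonpos)
    then show ?thesis using cpos[OF that] by linarith
  qed
  have zero: "c b0 - \<tau> * r b0 = 0" using b0 by simp
  define C where "C = insert a (B - {b0})"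
  have C: "C \<in> bases" unfolding C_def using pivot B(1) b0 a(1) by (simp add: r_def)
  \<comment> \<open>The coordinates of \<open>y\<close> in the new basis \<open>C\<close>.\<close>
  define f where "f b = (if b = a then \<tau> else c b - \<tau> * r b)" for b
  \<comment> \<open>Stated for an arbitrary \<open>g\<close>, since it is used with the identity to
    recompute \<open>y\<close> and with \<open>w\<close> to recompute the cost.\<close>
  have split: "(\<Sum>b\<in>C. f b *\<^sub>R g b) = \<tau> *\<^sub>R g a + (\<Sum>b\<in>B. (c b - \<tau> * r b) *\<^sub>R g b)"
    for g :: "'v \<Rightarrow> 'w::real_vector"
  proof -
    have "(\<Sum>b\<in>C. f b *\<^sub>R g b) = \<tau> *\<^sub>R g a + (\<Sum>b\<in>B - {b0}. f b *\<^sub>R g b)"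
      unfolding C_def using a fB by (subst sum.insert) (auto simp: f_def)
    also have "(\<Sum>b\<in>B - {b0}. f b *\<^sub>R g b) = (\<Sum>b\<in>B. (c b - \<tau> * r b) *\<^sub>R g b)"
      using a b0 fB zero by (intro sum.mono_neutral_cong_left) (auto simp: f_def)
    finally show ?thesis .
  qed
  have "(\<Sum>b\<in>C. f b *\<^sub>R b) = \<tau> *\<^sub>R a + (y - \<tau> *\<^sub>R a)"
    using split[of "\<lambda>b. b"] rep_sum[OF B(1) yA] rep_sum[OF B(1) aA]
    by (simp add: scaleR_diff_left sum_subtractf c_def r_def flip: scaleR_scaleR scaleR_sum_right)
  then have repC: "rep C y b = f b" if "b \<in> C" for b
    using representation_unique[OF bases_independent[OF C] bases_finite[OF C], of y f b] that by simp
  have "positive C y"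
    unfolding positive_def
  proof
    fix b assume b: "b \<in> C"
    have "0 \<le> f b" using b ge tau by (auto simp: f_def C_def)
    \<comment> \<open>A tie in the ratio test would produce a zero coordinate, which the genericity
      of \<open>y\<close> rules out; the new basis is therefore again positive.\<close>
    moreover have "f b \<noteq> 0" using y C b repC by (auto simp: generic_def)
    ultimately show "0 < rep C y b" using repC[OF b] by simp
  qed
  moreover have "cost C y < cost B y"
  proof -
    have "cost C y = (\<Sum>b\<in>C. f b *\<^sub>R w b)" by (simp add: cost_def repC)
    also have "\<dots> = \<tau> * w a + (cost B y - \<tau> * cost B a)"
      unfolding split by (simp add: cost_def c_def r_def left_diff_distrib sum_subtractf
        sum_distrib_left mult.assoc)
    also have "\<dots> < cost B y" using tau a(2) by simp
    finally show ?thesis .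
  qed
  ultimately show ?thesis using C by blast
qed

text \<open>Among the finitely many positive bases take one of least cost. A generator violating
  optimality would permit an improving pivot.\<close>

lemma ex_optimal_basis:
  assumes "y \<in> fcone A" "generic y"
  shows "\<exists>B\<in>optimal_bases. positive B y"
proof -
  define P where "P = {B\<in>bases. positive B y}"
  have P: "finite P" "P \<noteq> {}" using finite_bases ex_positive_basis[OF assms] by (auto simp: P_def)
  then obtain B where B: "B \<in> P" "\<And>C. C \<in> P \<Longrightarrow> cost B y \<le> cost C y"
    by (meson arg_min_if_finite(1) arg_min_least)
  have "cost B a < w a" if a: "a \<in> A - B" for a
  proof (rule ccontr)
    assume "\<not> cost B a < w a"
    moreover have "cost B a \<noteq> w a" using w_generic a B(1) by (simp add: cost_def P_def)
    ultimately obtain C where "C \<in> P" "cost C y < cost B y"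
      using improve[of B y a] B(1) assms(2) a by (auto simp: P_def)
    then show False using B(2) by force
  qed
  then show ?thesis using B(1) by (auto simp: P_def optimal_bases_def)
qed

section \<open>Half-open simplicial cones from an infinitesimal shift\<close>

text \<open>The points lying in the open simplicial cone spanned by \<open>B\<close> after an infinitesimal shift
  in the direction \<open>p\<close>.\<close>

definition piece :: "'v \<Rightarrow> 'v set \<Rightarrow> 'v set" where
  "piece p B = {x \<in> span A. \<forall>b\<in>B. 0 < rep B x b \<or> rep B x b = 0 \<and> 0 < rep B p b}"

definition shifted_cone :: "'v \<Rightarrow> 'v set" where
  "shifted_cone p = {x \<in> span A. \<forall>\<^sub>F \<epsilon> in at_right 0. x + \<epsilon> *\<^sub>R p \<in> fcone A}"

text \<open>For small positive shifts the sign of \<open>x + \<epsilon> * p\<close> is the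
  lexicographic sign of the pair of \<open>x\<close> and \<open>p\<close>.\<close>

lemma eventually_pos_shift:
  assumes "p \<noteq> (0::real)"
  shows "\<forall>\<^sub>F \<epsilon> in at_right 0. x + \<epsilon> * p \<noteq> 0 \<and> (0 < x + \<epsilon> * p \<longleftrightarrow> 0 < x \<or> x = 0 \<and> 0 < p)"
proof (cases "x = 0")
  case True
  have "\<forall>\<^sub>F \<epsilon> in at_right 0. 0 < (\<epsilon>::real)" by (rule eventually_at_right_less)
  then show ?thesis by eventually_elim (use True assms in \<open>auto simp: zero_less_mult_iff\<close>)
next
  case False
  have "\<forall>\<^sub>F \<epsilon> in at_right 0. 0 < \<epsilon> \<and> \<epsilon> < \<bar>x\<bar> / \<bar>p\<bar>"
    using False assms by (intro eventually_conj eventually_at_right_less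
      eventually_at_right_field[THEN iffD2])
      (auto intro!: exI[of _ "\<bar>x\<bar> / \<bar>p\<bar>"])
  then show ?thesis
  proof eventually_elim
    case (elim \<epsilon>)
    then have "\<bar>\<epsilon> * p\<bar> < \<bar>x\<bar>" using assms by (auto simp: abs_mult field_simps)
    then show ?case using False by auto
  qed
qed

text \<open>Only finitely many coordinates in finitely many bases are involved, so one small shift
  settles all of them. Statements about half-open pieces thereby become statements about ordinary
  positivity at a generic point.\<close>

lemma eventually_shift:
  assumes p: "generic p" and x: "x \<in> span A"
  shows "\<forall>\<^sub>F \<epsilon> in at_right 0. generic (x + \<epsilon> *\<^sub>R p) \<and>
    (\<forall>B\<in>bases. positive B (x + \<epsilon> *\<^sub>R p) \<longleftrightarrow> x \<in> piece p B)"
proof -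
  have pA: "p \<in> span A" using p by (simp add: generic_def)
  have "\<forall>\<^sub>F \<epsilon> in at_right 0. \<forall>B\<in>bases. \<forall>b\<in>B. rep B x b + \<epsilon> * rep B p b \<noteq> 0 \<and>
    (0 < rep B x b + \<epsilon> * rep B p b \<longleftrightarrow> 0 < rep B x b \<or> rep B x b = 0 \<and> 0 < rep B p b)"
    using p by (intro eventually_ball_finite finite_bases bases_finite ballI eventually_pos_shift)
      (auto simp: generic_def)
  then show ?thesis
    by eventually_elim
      (use x pA in \<open>auto simp: generic_def positive_def piece_def rep_add rep_scale span_add
        span_scale\<close>)
qed

lemma shifted_cone_iff:
  assumes p: "generic p" and x: "x \<in> span A"
  shows "x \<in> shifted_cone p \<longleftrightarrow> (\<exists>B\<in>optimal_bases. x \<in> piece p B)"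
proof
  assume "x \<in> shifted_cone p"
  then have "\<forall>\<^sub>F \<epsilon> in at_right 0. x + \<epsilon> *\<^sub>R p \<in> fcone A" by (simp add: shifted_cone_def)
  then have "\<forall>\<^sub>F \<epsilon> in at_right (0::real). \<exists>B\<in>optimal_bases. x \<in> piece p B"
    using eventually_shift[OF p x]
  proof eventually_elim
    case (elim \<epsilon>)
    then show ?case using ex_optimal_basis[of "x + \<epsilon> *\<^sub>R p"] by (auto simp: optimal_bases_def)
  qed
  \<comment> \<open>The claim no longer depends on the shift, and \<open>at_right 0\<close> is a
    nontrivial filter.\<close>
  then show "\<exists>B\<in>optimal_bases. x \<in> piece p B" by simp
next
  assume "\<exists>B\<in>optimal_bases. x \<in> piece p B"
  then obtain B where B: "B \<in> bases" "x \<in> piece p B" by (auto simp: optimal_bases_def)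
  have "\<forall>\<^sub>F \<epsilon> in at_right 0. x + \<epsilon> *\<^sub>R p \<in> fcone A"
    using eventually_shift[OF p x]
  proof eventually_elim
    case (elim \<epsilon>)
    let ?y = "x + \<epsilon> *\<^sub>R p"
    have "?y \<in> span A" "positive B ?y" using elim B by (auto simp: generic_def)
    then have "?y \<in> fcone B"
      using fconeI[of B "rep B ?y"] rep_sum[OF B(1), of ?y] by (auto simp: positive_def less_imp_le)
    then show ?case using fcone_mono[OF finite_A bases_subset[OF B(1)]] by blast
  qed
  then show "x \<in> shifted_cone p" using x by (simp add: shifted_cone_def)
qed

lemma piece_unique:
  assumes p: "generic p" and "B \<in> optimal_bases" "C \<in> optimal_bases" "x \<in> piece p B" "x \<in> piece p C"
  shows "B = C"
proof -
  have x: "x \<in> span A" using assms by (simp add: piece_def)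
  have "\<forall>\<^sub>F \<epsilon> in at_right (0::real). B = C"
    using eventually_shift[OF p x]
  proof eventually_elim
    case (elim \<epsilon>)
    then show ?case
      using optimal_basis_unique[of B C "x + \<epsilon> *\<^sub>R p"] assms
        by (auto simp: optimal_bases_def generic_def)
  qed
  then show ?thesis by simp
qed

lemma piece_subset_fcone:
  assumes "B \<in> bases" shows "piece p B \<subseteq> fcone A"
proof
  fix x assume x: "x \<in> piece p B"
  then have "0 \<le> rep B x b" if "b \<in> B" for b
    using that by (force simp: piece_def)
  then have "x \<in> fcone B"
    using fconeI[of B "rep B x"] rep_sum[OF assms, of x] x by (simp add: piece_def)
  then show "x \<in> fcone A" using fcone_mono[OF finite_A bases_subset[OF assms]] by blast
qed

text \<open>A shift in a direction of the cone never leaves the cone. Conversely, every shifted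
  point lies in some piece, and each piece is contained in the closed cone.\<close>

lemma shifted_cone_eq_fcone:
  assumes "generic p" "p \<in> fcone A"
  shows "shifted_cone p = fcone A"
proof
  show "shifted_cone p \<subseteq> fcone A"
    using shifted_cone_iff[OF assms(1)] piece_subset_fcone
    by (auto simp: shifted_cone_def optimal_bases_def) blast
  show "fcone A \<subseteq> shifted_cone p"
  proof
    fix x assume x: "x \<in> fcone A"
    have "\<forall>\<^sub>F \<epsilon> in at_right (0::real). 0 < \<epsilon>" by (rule eventually_at_right_less)
    then have "\<forall>\<^sub>F \<epsilon> in at_right 0. x + \<epsilon> *\<^sub>R p \<in> fcone A"
      by eventually_elim (rule fcone_add[OF x fcone_scale[OF assms(2)]], simp)
    then show "x \<in> shifted_cone p" using x fcone_subset_span by (auto simp: shifted_cone_def)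
  qed
qed

text \<open>If subtracting a small multiple of \<open>p\<close> stays in the cone, adding it back
  makes all coefficients positive. Conversely, finitely many positive coefficients survive a small
  subtraction.\<close>

lemma shifted_cone_eq_ocone:
  assumes \<alpha>: "\<And>a. a \<in> A \<Longrightarrow> 0 < \<alpha> a" and p: "p = (\<Sum>a\<in>A. \<alpha> a *\<^sub>R a)"
  shows "shifted_cone (- p) = ocone A"
proof
  show "shifted_cone (- p) \<subseteq> ocone A"
  proof
    fix x assume "x \<in> shifted_cone (- p)"
    then have "\<forall>\<^sub>F \<epsilon> in at_right 0. x + \<epsilon> *\<^sub>R (- p) \<in> fcone A" by (simp add: shifted_cone_def)
    then have "\<forall>\<^sub>F \<epsilon> in at_right (0::real). x \<in> ocone A"
      using eventually_at_right_less[of "0::real"]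
    proof eventually_elim
      case (elim \<epsilon>)
      then obtain c where c: "\<forall>a\<in>A. 0 \<le> c a" "x + \<epsilon> *\<^sub>R (- p) = (\<Sum>a\<in>A. c a *\<^sub>R a)"
        by (auto simp: fcone_def)
      then have "x = (\<Sum>a\<in>A. c a *\<^sub>R a) + \<epsilon> *\<^sub>R p" by (simp add: algebra_simps)
      then have "x = (\<Sum>a\<in>A. (c a + \<epsilon> * \<alpha> a) *\<^sub>R a)"
        by (simp add: p scaleR_add_left sum.distrib scaleR_sum_right)
      then show ?case using c(1) \<alpha> elim unfolding ocone_def
        by (intro CollectI exI[of _ "\<lambda>a. c a + \<epsilon> * \<alpha> a"]) (auto intro: add_nonneg_pos)
    qed
    then show "x \<in> ocone A" by simp
  qed
  show "ocone A \<subseteq> shifted_cone (- p)"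
  proof
    fix x assume xo: "x \<in> ocone A"
    then obtain c where c: "\<forall>a\<in>A. 0 < c a" "x = (\<Sum>a\<in>A. c a *\<^sub>R a)" by (auto simp: ocone_def)
    have "\<forall>\<^sub>F \<epsilon> in at_right 0. \<forall>a\<in>A. c a + \<epsilon> * (- \<alpha> a) \<noteq> 0 \<and> (0 < c a + \<epsilon> * (- \<alpha> a) \<longleftrightarrow> 0 < c a \<or>
      c a = 0 \<and> 0 < - \<alpha> a)"
      using \<alpha> by (intro eventually_ball_finite finite_A ballI eventually_pos_shift) force
    then have "\<forall>\<^sub>F \<epsilon> in at_right 0. x + \<epsilon> *\<^sub>R (- p) \<in> fcone A"
    proof eventually_elim
      case (elim \<epsilon>)
      have "x + \<epsilon> *\<^sub>R (- p) = (\<Sum>a\<in>A. (c a + \<epsilon> * (- \<alpha> a)) *\<^sub>R a)"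
        by (simp add: p c(2) scaleR_diff_left sum_subtractf scaleR_sum_right)
      then show ?case using fconeI[of A "\<lambda>a. c a + \<epsilon> * (- \<alpha> a)"] elim c(1) by (auto simp: less_imp_le)
    qed
    then show "x \<in> shifted_cone (- p)"
      using xo ocone_subset_fcone fcone_subset_span by (auto simp: shifted_cone_def)
  qed
qed

end

section \<open>Existence of generic weights and directions\<close>

context cone_generators
begin

lemma ex_generic_weights: "\<exists>w. cone_weights A deg w"
proof -
  \<comment> \<open>The pairing of \<open>\<phi> (B, a)\<close> with the weights is the height of
    the hyperplane over \<open>B\<close> at \<open>a\<close> minus \<open>w a\<close>. It is a
    nonzero form, since its coefficient at \<open>a\<close> is -1.\<close>
  define \<phi> where "\<phi> = (\<lambda>(B, a) b. (if b \<in> B then rep B a b else 0) - (if b = a then 1 else 0))"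
  have nz: "\<exists>b\<in>A. f b \<noteq> 0" if f: "f \<in> \<phi> ` (SIGMA B:bases. A - B)" for f
  proof -
    obtain B a where "a \<in> A - B" "f = \<phi> (B, a)" using f by auto
    then have "f a = -1" "a \<in> A" by (auto simp: \<phi>_def)
    then show ?thesis by (metis neg_equal_0_iff_equal zero_neq_one)
  qed
  have "finite (\<phi> ` (SIGMA B:bases. A - B))" using finite_bases finite_A by auto
  then obtain w where w: "\<And>f. f \<in> \<phi> ` (SIGMA B:bases. A - B) \<Longrightarrow> (\<Sum>b\<in>A. f b * w b) \<noteq> 0"
    using generic_weights[OF finite_A _ nz] by blast
  have "(\<Sum>b\<in>B. rep B a b * w b) \<noteq> w a" if B: "B \<in> bases" and a: "a \<in> A - B" for B a
  proof -
    have "(\<Sum>b\<in>A. \<phi> (B, a) b * w b) = (\<Sum>b\<in>A. if b \<in> B then rep B a b * w b else 0) - (\<Sum>b\<in>A.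
      if b = a then w b else 0)"
      unfolding sum_subtractf[symmetric] by (intro sum.cong) (auto simp: \<phi>_def algebra_simps)
    also have "\<dots> = (\<Sum>b\<in>B. rep B a b * w b) - w a"
      using finite_A a bases_subset[OF B] by (simp add: sum.inter_restrict[symmetric] Int_absorb1)
    finally show ?thesis using w[of "\<phi> (B, a)"] B a by auto
  qed
  then have "cone_weights A deg w"
    by unfold_locales
  then show ?thesis by blast
qed

lemma ex_generic_direction:
  obtains \<alpha> where "\<And>a. a \<in> A \<Longrightarrow> 0 < \<alpha> a" "generic (\<Sum>a\<in>A. \<alpha> a *\<^sub>R a)"
proof -
  \<comment> \<open>The pairing of \<open>\<phi> (B, b)\<close> with \<open>\<alpha>\<close> is the
    \<open>b\<close>-coordinate of the combination of the generators. Its coefficient at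
    \<open>b\<close> itself is 1.\<close>
  define \<phi> where "\<phi> = (\<lambda>(B, b) a. rep B a b)"
  have nz: "\<exists>b\<in>A. f b \<noteq> 0" if f: "f \<in> \<phi> ` (SIGMA B:bases. B)" for f
  proof -
    obtain B b where "B \<in> bases" "b \<in> B" "f = \<phi> (B, b)" using f by auto
    then have "f b = 1" "b \<in> A" using bases_subset by (auto simp: \<phi>_def rep_basis)
    then show ?thesis by (metis zero_neq_one)
  qed
  have "finite (\<phi> ` (SIGMA B:bases. B))" using finite_bases bases_finite by auto
  then obtain \<alpha> where \<alpha>: "\<And>a. a \<in> A \<Longrightarrow> 0 < \<alpha> a" "\<And>f. f \<in> \<phi> ` (SIGMA B:bases. B) \<Longrightarrow> (\<Sum>a\<in>A. f a * \<alpha> a) \<noteq> 0"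
    using generic_weights[OF finite_A _ nz] by blast
  have "rep B (\<Sum>a\<in>A. \<alpha> a *\<^sub>R a) b \<noteq> 0" if "B \<in> bases" "b \<in> B" for B b
  proof -
    have "\<phi> (B, b) \<in> \<phi> ` (SIGMA B:bases. B)" using that by blast
    from \<alpha>(2)[OF this] show ?thesis
      using that rep_combination[of B A "\<lambda>a. a" \<alpha> b] by (simp add: \<phi>_def span_base mult.commute)
  qed
  then have "generic (\<Sum>a\<in>A. \<alpha> a *\<^sub>R a)"
    unfolding generic_def by (intro conjI span_sum span_scale span_base ballI)
  then show thesis using that \<alpha>(1) by blast
qed

end

section \<open>Lattice points in cones and reciprocity\<close>

definition level :: "('v \<Rightarrow> real) \<Rightarrow> 'v set \<Rightarrow> nat \<Rightarrow> 'v set" where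
  "level f S n = {x \<in> S. f x = real n}"

text \<open>Since \<open>card\<close> is 0 on infinite sets, this is a true count only when all
  levels are finite, which \<open>finite_level\<close> provides for subsets of the lattice points of
  the cone.\<close>

definition hilbert_fps :: "('v \<Rightarrow> real) \<Rightarrow> 'v set \<Rightarrow> int fps" where
  "hilbert_fps f S = Abs_fps (\<lambda>n. int (card (level f S n)))"

lemma fps_nth_mult_one_minus_X:
  fixes F :: "'a::comm_ring_1 fps"
  shows "fps_nth (F * (1 - fps_X)) n = fps_nth F n - (if n = 0 then 0 else fps_nth F (n - 1))"
  by (simp add: right_diff_distrib)

locale lattice_cone = cone_generators A deg
  for A :: "'v::real_vector set" and deg :: "'v \<Rightarrow> real" +
  fixes L :: "'v set"
  assumes L_diff: "x \<in> L \<Longrightarrow> y \<in> L \<Longrightarrow> x - y \<in> L"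
    and A_subset_L: "A \<subseteq> L"
    and zero_L: "0 \<in> L"
    and finite_level: "finite (level deg (L \<inter> fcone A) n)"
begin

lemma L_add: "x \<in> L \<Longrightarrow> y \<in> L \<Longrightarrow> x + y \<in> L"
  using L_diff[of x "0 - y"] L_diff[OF zero_L, of y] by simp

lemma L_sum: "B \<subseteq> L \<Longrightarrow> \<Sum>B \<in> L"
  by (induction B rule: infinite_finite_induct) (auto simp: zero_L L_add)

end

section \<open>Box decomposition and reflection\<close>

locale lattice_cone_weights = cone_weights A deg w + lattice_cone A deg L
  for A :: "'v::real_vector set" and deg :: "'v \<Rightarrow> real" and w L
begin

text \<open>The coordinates in \<open>T\<close> range over a half-line, those in \<open>B - T\<close> over a half-open unit interval;
  the direction \<open>p\<close> decides which end points belong to them.\<close>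

definition region :: "'v \<Rightarrow> 'v set \<Rightarrow> 'v set \<Rightarrow> 'v set" where
  "region p B T = {x \<in> L \<inter> piece p B. \<forall>b\<in>B - T. rep B x b < 1 \<or> rep B x b = 1 \<and> rep B p b < 0}"

lemma region_subset: "B \<in> bases \<Longrightarrow> region p B T \<subseteq> L \<inter> fcone A"
  using piece_subset_fcone by (auto simp: region_def)

lemma finite_level_region: "B \<in> bases \<Longrightarrow> finite (level deg (region p B T) n)"
  using region_subset[of B p T] by (intro finite_subset[OF _ finite_level[of n]]) (auto simp: level_def)

lemma deg_piece_nonneg:
  assumes "B \<in> bases" "x \<in> piece p B" shows "0 \<le> deg x"
proof -
  have "0 \<le> rep B x b" if "b \<in> B" for b using that assms by (force simp: piece_def)
  then show ?thesis using assms by (simp add: deg_rep piece_def sum_nonneg)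
qed

lemma rep_add_basis:
  assumes "B \<in> bases" "b \<in> B" "x \<in> span A"
  shows "rep B (x + b) c = rep B x c + (if c = b then 1 else 0)"
    and "rep B (x - b) c = rep B x c - (if c = b then 1 else 0)"
proof -
  have "b \<in> span A" using bases_subset[OF assms(1)] assms(2) by (auto intro: span_base)
  then show "rep B (x + b) c = rep B x c + (if c = b then 1 else 0)"
    "rep B (x - b) c = rep B x c - (if c = b then 1 else 0)"
    using assms by (simp_all add: rep_add rep_diff rep_basis)
qed

text \<open>In the direction \<open>b\<close> a half-line is the disjoint union of its first
  half-open unit interval and its own translate by 1.\<close>

lemma region_insert:
  assumes B: "B \<in> bases" and b: "b \<in> B" "b \<notin> T" and p: "generic p"
  shows "region p B (insert b T) = region p B T \<union> (\<lambda>x. x + b) ` region p B (insert b T)"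
    and "region p B T \<inter> (\<lambda>x. x + b) ` region p B (insert b T) = {}"
proof -
  have bL: "b \<in> L" "b \<in> span A"
    using bases_subset[OF B] b A_subset_L by (auto intro: span_base)
  \<comment> \<open>The sign decides the end points: the interval contains 0 but not 1 if it is
    positive, and 1 but not 0 if it is negative. Subtracting \<open>b\<close> from a point beyond
    the interval therefore stays on the half-line.\<close>
  have pb: "rep B p b \<noteq> 0" using p B b by (simp add: generic_def)
  have plus: "x + b \<in> region p B (insert b T)" if "x \<in> region p B (insert b T)" for x
    using that bL L_add[of x b] b
    by (auto simp: region_def piece_def rep_add_basis[OF B b(1)] span_add)
  have minus: "x - b \<in> region p B (insert b T)"
    if "x \<in> region p B (insert b T)" "x \<notin> region p B T" for x
    using that bL L_diff[of x b] b pb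
    by (auto simp: region_def piece_def rep_add_basis[OF B b(1)] span_diff)
  have "region p B T \<subseteq> region p B (insert b T)" by (auto simp: region_def)
  moreover have "x \<in> (\<lambda>x. x + b) ` region p B (insert b T)"
    if "x \<in> region p B (insert b T)" "x \<notin> region p B T" for x
    using minus[OF that] by (intro image_eqI[of _ _ "x - b"]) auto
  ultimately show "region p B (insert b T) = region p B T \<union> (\<lambda>x. x + b) ` region p B (insert b T)"
    using plus by blast
  have "x + b \<notin> region p B T" if "x \<in> region p B (insert b T)" for x
  proof
    have x: "x \<in> span A" using that by (simp add: region_def piece_def)
    assume "x + b \<in> region p B T"
    then have "rep B (x + b) b < 1 \<or> rep B (x + b) b = 1 \<and> rep B p b < 0"
      using b by (simp add: region_def)
    then have "rep B x b < 0 \<or> rep B x b = 0 \<and> rep B p b < 0"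
      by (simp add: rep_add_basis[OF B b(1) x])
    then show False using that b(1) by (auto simp: region_def piece_def)
  qed
  then show "region p B T \<inter> (\<lambda>x. x + b) ` region p B (insert b T) = {}" by blast
qed

text \<open>Translation by \<open>b\<close> raises the degree by 1, so the decomposition in
  \<open>region_insert\<close> multiplies the translated part by the variable.\<close>

lemma hilbert_fps_region_insert:
  assumes B: "B \<in> bases" and b: "b \<in> B" "b \<notin> T" and p: "generic p"
  shows "hilbert_fps deg (region p B (insert b T)) * (1 - fps_X) = hilbert_fps deg (region p B T)"
proof (rule fps_ext)
  fix n
  let ?R = "region p B (insert b T)" and ?S = "region p B T"
  have degb: "deg (x + b) = deg x + 1" for x
    using linear_add[OF linear_deg] deg_A bases_subset[OF B] b by auto
  \<comment> \<open>Degrees are nonnegative, so no translated point has degree 0; hence the case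
    \<open>n = 0\<close> has no preceding level.\<close>
  have neg: "deg x + 1 \<noteq> 0" if "x \<in> ?R" for x
    using deg_piece_nonneg[OF B] that by (force simp: region_def)
  have "level deg ?R n = level deg ?S n \<union> (\<lambda>x. x + b) ` {x \<in> ?R. deg x + 1 = real n}"
    using region_insert(1)[OF assms] degb by (auto simp: level_def)
  also have "{x \<in> ?R. deg x + 1 = real n} = (if n = 0 then {} else level deg ?R (n - 1))"
    using neg by (auto simp: level_def of_nat_diff)
  finally have eq: "level deg ?R n = level deg ?S n \<union> (\<lambda>x. x + b) ` (if n =
    0 then {} else level deg ?R (n - 1))" .
  have "card (level deg ?R n) =
      card (level deg ?S n) + card (if n = 0 then {} else level deg ?R (n - 1))"
    unfolding eq
  proof (subst card_Un_disjoint)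
    show "level deg ?S n \<inter> (\<lambda>x. x + b) ` (if n = 0 then {} else level deg ?R (n - 1)) = {}"
      using region_insert(2)[OF assms] by (auto simp: level_def)
  qed (use finite_level_region[OF B] in \<open>auto simp: card_image\<close>)
  then show "fps_nth (hilbert_fps deg ?R * (1 - fps_X)) n = fps_nth (hilbert_fps deg ?S) n"
    unfolding fps_nth_mult_one_minus_X by (auto simp: hilbert_fps_def)
qed

lemma hilbert_fps_region:
  assumes B: "B \<in> bases" and p: "generic p" and T: "T \<subseteq> B"
  shows "hilbert_fps deg (region p B T) * (1 - fps_X) ^ card T = hilbert_fps deg (region p B {})"
proof -
  have "finite T" using T bases_finite[OF B] finite_subset by blast
  then show ?thesis using T
  proof induction
    case (insert b T)
    then show ?case using hilbert_fps_region_insert[OF B _ insert(2) p]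
      by (simp add: mult.assoc[symmetric])
  qed simp
qed

text \<open>The map replaces every coordinate by 1 minus itself. It exchanges the two kinds of
  half-open unit interval, as the change from \<open>p\<close> to \<open>- p\<close> does.\<close>

lemma region_empty_reflect:
  assumes B: "B \<in> bases" and p: "generic p" and x: "x \<in> region p B {}"
  shows "\<Sum>B - x \<in> region (- p) B {}" and "deg (\<Sum>B - x) = real (card B) - deg x"
    and "deg x \<le> real (card B)"
proof -
  have x': "x \<in> L" "x \<in> span A" using x by (auto simp: region_def piece_def)
  have BA: "B \<subseteq> A" by (rule bases_subset[OF B])
  have S: "\<Sum>B \<in> span A" "\<Sum>B \<in> L"
    using BA A_subset_L by (auto intro: span_sum span_base L_sum)
  have repS: "rep B (\<Sum>B) b = 1" if "b \<in> B" for b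
    using representation_unique[OF bases_independent[OF B] bases_finite[OF B], of "\<Sum>B" "\<lambda>_. 1" b] that
      by simp
  have pA: "p \<in> span A" using p by (simp add: generic_def)
  show "\<Sum>B - x \<in> region (- p) B {}"
    using x' S x by (auto simp: region_def piece_def L_diff span_diff rep_diff[OF B] repS rep_neg[OF B
      pA])
  show "deg (\<Sum>B - x) = real (card B) - deg x"
    using S x' by (simp add: deg_rep[OF B] rep_diff[OF B] repS span_diff sum_subtractf)
  have "rep B x b \<le> 1" if "b \<in> B" for b using x that by (force simp: region_def)
  then show "deg x \<le> real (card B)"
    using sum_mono[of B "rep B x" "\<lambda>_. 1"] by (simp add: deg_rep[OF B x'(2)])
qed

lemma generic_minus: "generic p \<Longrightarrow> generic (- p)"
  by (auto simp: generic_def span_neg rep_neg)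

lemma hilbert_fps_box_reflect:
  assumes B: "B \<in> bases" and p: "generic p"
  shows "fps_nth (hilbert_fps deg (region (- p) B {})) n =
    (if n \<le> dim A then fps_nth (hilbert_fps deg (region p B {})) (dim A - n) else 0)"
proof (cases "n \<le> dim A")
  case True
  have p': "generic (- p)" by (rule generic_minus[OF p])
  have "bij_betw (\<lambda>x. \<Sum>B - x) (level deg (region (- p) B {}) n) (level deg (region p B {}) (dim A - n))"
    by (rule bij_betw_byWitness[of _ "\<lambda>x. \<Sum>B - x"])
      (use True region_empty_reflect[OF B p] region_empty_reflect[OF B p'] bases_card[OF B] in
        \<open>auto simp: level_def of_nat_diff\<close>)
  then show ?thesis using True by (simp add: hilbert_fps_def bij_betw_same_card)
next
  case False
  then have "level deg (region (- p) B {}) n = {}"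
    using region_empty_reflect(3)[OF B generic_minus[OF p]] bases_card[OF B] by (force simp: level_def)
  then show ?thesis using False by (simp add: hilbert_fps_def)
qed

lemma finite_optimal_bases: "finite optimal_bases"
  using finite_bases by (simp add: optimal_bases_def)

text \<open>The pieces of the optimal bases partition the shifted cone, and all bases have
  \<open>dim A\<close> elements, so one power of \<open>1 - fps_X\<close> clears every
  denominator.\<close>

lemma hilbert_fps_shifted_cone:
  assumes p: "generic p"
  shows "hilbert_fps deg (L \<inter> shifted_cone p) * (1 - fps_X) ^ dim A =
    (\<Sum>B\<in>optimal_bases. hilbert_fps deg (region p B {}))"
proof -
  have ob: "B \<in> bases" if "B \<in> optimal_bases" for B using that by (simp add: optimal_bases_def)
  have full: "region p B B = L \<inter> piece p B" for B by (auto simp: region_def)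
  have "hilbert_fps deg (L \<inter> shifted_cone p) = (\<Sum>B\<in>optimal_bases. hilbert_fps deg (region p B B))"
  proof (rule fps_ext)
    fix n
    have "level deg (L \<inter> shifted_cone p) n = (\<Union>B\<in>optimal_bases. level deg (region p B B) n)"
      using shifted_cone_iff[OF p] unfolding full by (auto simp: level_def piece_def shifted_cone_def)
    moreover have "card (\<Union>B\<in>optimal_bases. level deg (region p B B) n) =
        (\<Sum>B\<in>optimal_bases. card (level deg (region p B B) n))"
    proof (intro card_UN_disjoint ballI impI)
      show "finite (level deg (region p B B) n)" if "B \<in> optimal_bases" for B
        by (rule finite_level_region[OF ob[OF that]])
      show "level deg (region p B B) n \<inter> level deg (region p C C) n = {}"
        if "B \<in> optimal_bases" "C \<in> optimal_bases" "B \<noteq> C" for B C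
        using piece_unique[OF p that(1,2)] that(3) by (auto simp: full level_def)
    qed (rule finite_optimal_bases)
    ultimately show "fps_nth (hilbert_fps deg (L \<inter> shifted_cone p)) n =
        fps_nth (\<Sum>B\<in>optimal_bases. hilbert_fps deg (region p B B)) n"
      by (simp add: hilbert_fps_def fps_sum_nth)
  qed
  then show ?thesis
    using hilbert_fps_region[OF _ p order_refl] ob bases_card
    by (simp add: sum_distrib_right)
qed

end

context lattice_cone
begin

text \<open>Stanley's reciprocity between a cone and its interior: the same triangulation is read
  once with direction \<open>p\<close> and once with \<open>- p\<close>.\<close>

theorem hilbert_fps_reciprocity:
  "\<exists>h :: int poly. hilbert_fps deg (L \<inter> fcone A) * (1 - fps_X) ^ dim A = fps_of_poly h \<and>
    (\<forall>n. fps_nth (hilbert_fps deg (L \<inter> ocone A) * (1 - fps_X) ^ dim A) n =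
      (if n \<le> dim A then coeff h (dim A - n) else 0)) \<and> degree h \<le> dim A"
proof -
  obtain w where "cone_weights A deg w" using ex_generic_weights by blast
  then interpret lattice_cone_weights A deg w L
    by (simp add: lattice_cone_weights_def lattice_cone_axioms)
  obtain \<alpha> where \<alpha>: "\<And>a. a \<in> A \<Longrightarrow> 0 < \<alpha> a" and p0: "generic (\<Sum>a\<in>A. \<alpha> a *\<^sub>R a)"
    by (rule ex_generic_direction) blast
  define p where "p = (\<Sum>a\<in>A. \<alpha> a *\<^sub>R a)"
  have p: "generic p" "p \<in> fcone A" using p0 \<alpha> by (auto simp: p_def intro!: fconeI less_imp_le)
  define F where "F q = (\<Sum>B\<in>optimal_bases. hilbert_fps deg (region q B {}))" for q
  have reflect: "fps_nth (F (- q)) n = (if n \<le> dim A then fps_nth (F q) (dim A - n) else 0)"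
    if "generic q" for q n
    unfolding F_def fps_sum_nth
    by (cases "n \<le> dim A") (auto simp: hilbert_fps_box_reflect that optimal_bases_def intro!: sum.cong
      sum.neutral)
  \<comment> \<open>Reflection applied to \<open>- p\<close> returns to \<open>p\<close> and shows
    that the box series has no terms beyond \<open>dim A\<close>.\<close>
  have big: "fps_nth (F p) n = 0" if "n > dim A" for n
    using reflect[OF generic_minus[OF p(1)], of n] that by simp
  define h where "h = (\<Sum>n\<le>dim A. monom (fps_nth (F p) n) n)"
  have coeff: "coeff h n = fps_nth (F p) n" for n
    using big[of n] by (simp add: h_def coeff_sum)
  have "hilbert_fps deg (L \<inter> fcone A) * (1 - fps_X) ^ dim A = fps_of_poly h"
    using hilbert_fps_shifted_cone[OF p(1)] shifted_cone_eq_fcone[OF p]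
    by (simp add: fps_eq_iff coeff flip: F_def)
  moreover have "hilbert_fps deg (L \<inter> ocone A) * (1 - fps_X) ^ dim A = F (- p)"
    using hilbert_fps_shifted_cone[OF generic_minus[OF p(1)]] shifted_cone_eq_ocone[OF \<alpha> p_def]
    by (simp flip: F_def)
  moreover have "degree h \<le> dim A" by (rule degree_le) (simp add: coeff big)
  ultimately show ?thesis using reflect[OF p(1)] coeff by auto
qed

end

section \<open>Normality of the edge semigroup\<close>

definition edge_vector :: "nat set \<Rightarrow> (nat \<Rightarrow>\<^sub>0 real)" where
  "edge_vector e = (\<Sum>i\<in>e. Poly_Mapping.single i 1)"

definition edge_vector_sums :: "edges \<Rightarrow> (nat \<Rightarrow>\<^sub>0 real) set" where
  "edge_vector_sums E = {sum_list (map edge_vector es) | es. set es \<subseteq> E}"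

definition half_total :: "nat \<Rightarrow> (nat \<Rightarrow>\<^sub>0 real) \<Rightarrow> real" where
  "half_total d x = (\<Sum>i\<in>{1..d}. Poly_Mapping.lookup x i) / 2"

text \<open>For bipartite graphs the edge vectors generate a smaller group. Only the points inside
  the cone matter, however, so this lattice serves bipartite and nonbipartite graphs alike.\<close>

definition even_lattice :: "nat \<Rightarrow> (nat \<Rightarrow>\<^sub>0 real) set" where
  "even_lattice d = {x. (\<forall>i. Poly_Mapping.lookup x i \<in> \<int>) \<and> half_total d x \<in> \<int>}"

lemma lookup_scaleR_real:
  "Poly_Mapping.lookup (r *\<^sub>R x) i = r * Poly_Mapping.lookup (x :: 'a \<Rightarrow>\<^sub>0 real) i"
proof -
  have "finite {i. r * Poly_Mapping.lookup x i \<noteq> 0}"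
    by (rule finite_subset[of _ "Poly_Mapping.keys x"]) (auto simp: in_keys_iff)
  then show ?thesis by (simp add: scaleR_poly_mapping_def)
qed

lemma lookup_sum_single:
  "finite W \<Longrightarrow> Poly_Mapping.lookup (\<Sum>i\<in>W. Poly_Mapping.single i (1::real)) v = (if v \<in> W then 1 else 0)"
  by (simp add: lookup_sum lookup_single when_def)

lemma lookup_edge_vector: "finite e \<Longrightarrow> Poly_Mapping.lookup (edge_vector e) i = (if i \<in> e then 1 else 0)"
  by (simp add: edge_vector_def lookup_sum_single)

lemma lookup_edge_combination:
  assumes "finite F" "\<And>e. e \<in> F \<Longrightarrow> finite e"
  shows "Poly_Mapping.lookup (\<Sum>e\<in>F. c e *\<^sub>R edge_vector e) v = (\<Sum>e\<in>{e \<in> F. v \<in> e}. c e)"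
proof -
  have "Poly_Mapping.lookup (\<Sum>e\<in>F. c e *\<^sub>R edge_vector e) v = (\<Sum>e\<in>F. if v \<in> e then c e else 0)"
    unfolding lookup_sum by (intro sum.cong) (auto simp: lookup_scaleR_real lookup_edge_vector assms)
  then show ?thesis using assms(1) by (simp add: sum.inter_filter)
qed

lemma edge_vector_inj:
  assumes e: "finite e" "finite f" "edge_vector e = edge_vector f"
  shows "e = f"
proof (rule Set.set_eqI)
  fix i
  have "Poly_Mapping.lookup (edge_vector e) i = Poly_Mapping.lookup (edge_vector f) i" using e(3)
    by simp
  then show "i \<in> e \<longleftrightarrow> i \<in> f" using e(1,2) by (simp add: lookup_edge_vector split: if_splits)
qed

lemma linear_half_total: "linear (half_total d)"
  by (rule linearI) (simp_all add: half_total_def lookup_add lookup_scaleR_real sum.distrib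
      add_divide_distrib flip: sum_distrib_left)

lemma half_total_sum_single:
  assumes "W \<subseteq> {1..d}" shows "half_total d (\<Sum>i\<in>W. Poly_Mapping.single i 1) = card W / 2"
proof -
  have "finite W" using assms finite_subset by blast
  moreover have "(\<Sum>i\<in>{1..d}. if i \<in> W then 1 else 0) = (\<Sum>i\<in>W. 1::real)"
    using assms by (intro sum.mono_neutral_cong_right) auto
  ultimately show ?thesis by (simp add: half_total_def lookup_sum_single)
qed

lemma edge_vector_sums_add:
  "x \<in> edge_vector_sums E \<Longrightarrow> y \<in> edge_vector_sums E \<Longrightarrow> x + y \<in> edge_vector_sums E"
  unfolding edge_vector_sums_def
  by clarify (rename_tac es fs, rule_tac x = "es @ fs" in exI, simp)

lemma edge_vector_sums_zero: "0 \<in> edge_vector_sums E"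
  unfolding edge_vector_sums_def by (auto intro!: exI[of _ "[]"])

lemma edge_vector_sums_edge: "e \<in> E \<Longrightarrow> edge_vector e \<in> edge_vector_sums E"
  unfolding edge_vector_sums_def by (auto intro!: exI[of _ "[e]"])

section \<open>Cycles with matchable vertex sets\<close>

text \<open>Every second edge of a path with an even number of vertices forms a perfect matching of
  it.\<close>

lemma path_in_edge_vector_sums:
  assumes "\<And>e. e \<in> E \<Longrightarrow> card e = 2" "successively (\<lambda>u v. {u, v} \<in> E) p" "even (length p)"
  shows "sum_list (map (\<lambda>i. Poly_Mapping.single i 1) p) \<in> edge_vector_sums E"
  using assms(2,3)
proof (induction p rule: induct_list012)
  case (3 u v p)
  have uv: "{u, v} \<in> E" using 3 by simp
  then have "u \<noteq> v" using assms(1) by force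
  then have "edge_vector {u, v} = Poly_Mapping.single u 1 + Poly_Mapping.single v 1"
    by (simp add: edge_vector_def)
  moreover have "successively (\<lambda>u v. {u, v} \<in> E) p"
    using 3(3) by (cases p) auto
  ultimately show ?case
    using edge_vector_sums_add[OF edge_vector_sums_edge[OF uv] 3(1)] 3(4) by (simp add: add.assoc)
qed (auto simp: edge_vector_sums_zero)

text \<open>Opens the cycle into a path beginning at a prescribed vertex, so that this vertex can be
  split off.\<close>

lemma graph_cycle_rotate:
  assumes "graph_cycle E vs" "v \<in> set vs"
  obtains p where "distinct (v # p)" "set (v # p) = set vs" "successively (\<lambda>u v. {u, v} \<in> E) (v # p)"
proof -
  let ?n = "length vs"
  obtain k where k: "k < ?n" "v = vs ! k" using assms(2) by (auto simp: in_set_conv_nth)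
  define q where "q = rotate k vs"
  have n: "?n \<ge> 3" "distinct vs" and E: "\<And>i. i < ?n \<Longrightarrow> {vs ! i, vs ! ((i + 1) mod ?n)} \<in> E"
    using assms(1) by (auto simp: graph_cycle_def)
  have "successively (\<lambda>u v. {u, v} \<in> E) q"
    unfolding successively_conv_nth
  proof (intro allI impI)
    fix i assume i: "Suc i < length q"
    then have "{vs ! ((k + i) mod ?n), vs ! (((k + i) mod ?n + 1) mod ?n)} \<in> E"
      by (intro E mod_less_divisor) (use n in linarith)
    moreover have "((k + i) mod ?n + 1) mod ?n = (k + Suc i) mod ?n" by (simp add: mod_Suc_eq)
    ultimately show "{q ! i, q ! Suc i} \<in> E" using i by (simp add: q_def nth_rotate)
  qed
  moreover have "0 < ?n" using n by linarith
  then have "q ! 0 = v" "q \<noteq> []" using nth_rotate[of 0 vs k] k by (auto simp: q_def)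
  moreover have "distinct q" "set q = set vs" using n by (auto simp: q_def)
  ultimately show thesis using that by (cases q) auto
qed

lemma graph_cycle_mono: "graph_cycle F vs \<Longrightarrow> F \<subseteq> E \<Longrightarrow> graph_cycle E vs"
  unfolding graph_cycle_def by blast

lemma graph_cycle_vertices:
  assumes "graph_cycle F vs"
  shows "set vs \<subseteq> \<Union>F" and "0 < card (set vs)"
proof
  fix v assume "v \<in> set vs"
  then obtain i where "i < length vs" "v = vs ! i" by (auto simp: in_set_conv_nth)
  then have "{v, vs ! ((i + 1) mod length vs)} \<in> F" using assms by (auto simp: graph_cycle_def)
  then show "v \<in> \<Union>F" by blast
next
  have "vs \<noteq> []" using assms by (auto simp: graph_cycle_def)
  then show "0 < card (set vs)" by (simp add: card_gt_0_iff)
qed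

lemma even_cycle_in_edge_vector_sums:
  assumes "\<And>e. e \<in> E \<Longrightarrow> card e = 2" "graph_cycle E vs" "even (length vs)"
  shows "(\<Sum>i\<in>set vs. Poly_Mapping.single i 1) \<in> edge_vector_sums E"
proof -
  have "vs \<noteq> []" using assms(2) by (auto simp: graph_cycle_def)
  then obtain p where p: "distinct (hd vs # p)" "set (hd vs # p) = set vs"
      "successively (\<lambda>u v. {u, v} \<in> E) (hd vs # p)"
    using graph_cycle_rotate[OF assms(2)] hd_in_set by metis
  have "length (hd vs # p) = length vs"
    using p(1,2) assms(2) distinct_card unfolding graph_cycle_def by metis
  then have "even (length (hd vs # p))" using assms(3) by simp
  from path_in_edge_vector_sums[OF assms(1) p(3) this] show ?thesis
    by (simp only: sum_list_distinct_conv_sum_set[OF p(1)] p(2))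
qed

text \<open>Removing \<open>v\<close> and \<open>u\<close> leaves two paths with an even number of
  vertices, and the connecting edge matches \<open>v\<close> with \<open>u\<close>.\<close>

lemma odd_cycle_pair_in_edge_vector_sums:
  assumes card2: "\<And>e. e \<in> E \<Longrightarrow> card e = 2" and vs: "odd_cycle E vs" and us: "odd_cycle E us"
    and e: "v \<in> set vs" "u \<in> set us" "{v, u} \<in> E"
  shows "(\<Sum>i\<in>set vs. Poly_Mapping.single i 1) + (\<Sum>i\<in>set us. Poly_Mapping.single i 1) \<in>
    edge_vector_sums E"
proof -
  have half: "\<exists>y\<in>edge_vector_sums E. (\<Sum>i\<in>set vs. Poly_Mapping.single i 1) = Poly_Mapping.single v 1 + y"
    if vs: "odd_cycle E vs" "v \<in> set vs" for v vs
  proof -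
    obtain p where p: "distinct (v # p)" "set (v # p) = set vs"
      "successively (\<lambda>u v. {u, v} \<in> E) (v # p)"
      using graph_cycle_rotate vs unfolding odd_cycle_def by metis
    have "length (v # p) = length vs"
      using p(1,2) vs(1) distinct_card unfolding odd_cycle_def graph_cycle_def by metis
    then have "even (length p)" using vs(1) by (metis even_Suc length_Cons odd_cycle_def)
    moreover have "successively (\<lambda>u v. {u, v} \<in> E) p" using p(3) by (cases p) auto
    ultimately have "sum_list (map (\<lambda>i. Poly_Mapping.single i 1) p) \<in> edge_vector_sums E"
      using path_in_edge_vector_sums[OF card2] by blast
    moreover have "(\<Sum>i\<in>set vs. Poly_Mapping.single i (1::real)) =
      sum_list (map (\<lambda>i. Poly_Mapping.single i 1) (v # p))"
      by (simp only: sum_list_distinct_conv_sum_set[OF p(1)] p(2))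
    ultimately show ?thesis by auto
  qed
  obtain y z where y: "y \<in> edge_vector_sums E" "(\<Sum>i\<in>set vs. Poly_Mapping.single i 1) =
    Poly_Mapping.single v 1 + y"
    and z: "z \<in> edge_vector_sums E" "(\<Sum>i\<in>set us. Poly_Mapping.single i 1) = Poly_Mapping.single u 1 + z"
    using half[OF vs e(1)] half[OF us e(2)] by blast
  have "v \<noteq> u" using card2[OF e(3)] by force
  then have "(\<Sum>i\<in>set vs. Poly_Mapping.single i 1) + (\<Sum>i\<in>set us. Poly_Mapping.single i 1) =
    edge_vector {v, u} + (y + z)"
    unfolding y(2) z(2) by (simp add: edge_vector_def add_ac)
  then show ?thesis using edge_vector_sums_add edge_vector_sums_edge[OF e(3)] y(1) z(1) by metis
qed

text \<open>A finite disjoint union of cycles, expressed by degrees on the vertices that are covered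
  by \<open>F\<close>.\<close>

definition two_regular :: "edges \<Rightarrow> bool" where
  "two_regular F \<longleftrightarrow> finite F \<and> (\<forall>e\<in>F. card e = 2) \<and> (\<forall>v\<in>\<Union>F. card {e \<in> F. v \<in> e} = 2)"

text \<open>The second edge at the first vertex of a longest path must return to the path and close
  a cycle. Its vertices then have both their edges on the cycle, so it is a whole component.\<close>

lemma two_regular_cycle:
  assumes F: "two_regular F" "F \<noteq> {}"
  obtains vs where "graph_cycle F vs" "\<And>e. e \<in> F \<Longrightarrow> e \<inter> set vs \<noteq> {} \<Longrightarrow> e \<subseteq> set vs"
proof -
  have card2: "\<And>e. e \<in> F \<Longrightarrow> card e = 2" using F by (simp add: two_regular_def)
  have "finite e" if "e \<in> F" for e using card2[OF that] card.infinite by fastforce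
  then have finF: "finite (\<Union>F)" using F by (simp add: two_regular_def)
  define P where "P p \<longleftrightarrow> distinct p \<and> successively (\<lambda>u v. {u, v} \<in> F) p \<and> length p \<ge> 2" for p
  have subset: "set p \<subseteq> \<Union>F" if "P p" for p
  proof
    fix x assume "x \<in> set p"
    then obtain i where i: "i < length p" "x = p ! i" by (auto simp: in_set_conv_nth)
    have "\<exists>y. {x, y} \<in> F"
    proof (cases i)
      case 0
      then have "{p ! 0, p ! Suc 0} \<in> F" using that by (auto simp: P_def successively_conv_nth)
      then show ?thesis using i 0 by auto
    next
      case (Suc j)
      then have "{p ! j, p ! Suc j} \<in> F" using that i by (auto simp: P_def successively_conv_nth)
      then show ?thesis using i Suc by (auto simp: insert_commute)
    qed
    then show "x \<in> \<Union>F" by auto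
  qed
  obtain e0 where "e0 \<in> F" using F by blast
  then obtain a b where "{a, b} \<in> F" "a \<noteq> b" using card2 card_2_iff by metis
  then have "P [a, b]" by (simp add: P_def)
  moreover have "\<forall>p. P p \<longrightarrow> length p < Suc (card (\<Union>F))"
  proof (intro allI impI)
    fix p assume "P p"
    then show "length p < Suc (card (\<Union>F))"
      using card_mono[OF finF subset, of p] distinct_card[of p] by (simp add: P_def)
  qed
  ultimately have "\<exists>p. P p \<and> (\<forall>q. P q \<longrightarrow> length q \<le> length p)"
    by (rule Lattices_Big.ex_has_greatest_nat)
  then obtain p where p: "P p" and longest: "\<And>q. P q \<Longrightarrow> length q \<le> length p"
    by (elim exE conjE) simp
  have p01: "{p ! 0, p ! 1} \<in> F" and ne: "p \<noteq> []" and dist: "distinct p" and len: "length p \<ge> 2"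
    using p by (auto simp: P_def successively_conv_nth)
  have "card {e \<in> F. p ! 0 \<in> e} = 2" using F p01 by (auto simp: two_regular_def)
  then obtain e where e: "e \<in> F" "p ! 0 \<in> e" "e \<noteq> {p ! 0, p ! 1}"
    by (metis (mono_tags, lifting) card_2_iff' mem_Collect_eq)
  then obtain u where u: "e = {p ! 0, u}" "u \<noteq> p ! 0"
    using card2[OF e(1)] e(2) by (auto simp: card_2_iff)
  have "u \<in> set p"
  proof (rule ccontr)
    assume "u \<notin> set p"
    then have "P (u # p)" using p e(1) u ne
      by (cases p) (auto simp: P_def insert_commute)
    then show False using longest by fastforce
  qed
  then obtain j where j: "j < length p" "u = p ! j" by (auto simp: in_set_conv_nth)
  \<comment> \<open>The closing edge differs from the first edge of the path, so it does not end at
    the second vertex; this gives the cycle at least three vertices.\<close>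
  have "j \<noteq> 0" "j \<noteq> 1" using u e j by auto
  then have j2: "j \<ge> 2" by simp
  define vs where "vs = take (Suc j) p"
  have lvs: "length vs = Suc j" and nvs: "\<And>i. i \<le> j \<Longrightarrow> vs ! i = p ! i" using j by (auto simp: vs_def)
  have dvs: "distinct vs" using dist by (simp add: vs_def)
  have edge: "{vs ! i, vs ! ((i + 1) mod length vs)} \<in> F" if "i < length vs" for i
  proof (cases "i = j")
    case True
    then show ?thesis using e(1) u j by (simp add: lvs nvs insert_commute)
  next
    case False
    then have "i < j" using that lvs by simp
    then have "{p ! i, p ! Suc i} \<in> F" using p j by (auto simp: P_def successively_conv_nth)
    then show ?thesis using \<open>i < j\<close> by (simp add: lvs nvs)
  qed
  have cyc: "graph_cycle F vs" using edge dvs j2 lvs by (simp add: graph_cycle_def)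
  have "f \<subseteq> set vs" if f: "f \<in> F" "f \<inter> set vs \<noteq> {}" for f
  proof -
    obtain i where i: "i < length vs" "vs ! i \<in> f" using f(2) by (auto simp: in_set_conv_nth)
    \<comment> \<open>The cyclic predecessor of \<open>i\<close>. The edges to predecessor and
      successor are distinct and so exhaust the two edges at this vertex.\<close>
    define k where "k = (if i = 0 then j else i - 1)"
    have k: "k < length vs" "(k + 1) mod length vs = i" using i lvs by (auto simp: k_def)
    let ?l = "(i + 1) mod length vs"
    have l: "?l < length vs" using lvs by simp
    have "k \<noteq> ?l"
    proof (cases "i = j")
      case True then show ?thesis using j2 lvs by (simp add: k_def)
    next
      case False then show ?thesis using i j2 lvs by (auto simp: k_def)
    qed
    moreover have "i \<noteq> k" "i \<noteq> ?l" using i lvs j2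
      by (auto simp: k_def mod_Suc split: if_splits)
    ultimately have "vs ! k \<noteq> vs ! ?l" "vs ! i \<noteq> vs ! k" "vs ! i \<noteq> vs ! ?l"
      using dvs i(1) k(1) l by (auto simp: nth_eq_iff_index_eq)
    then have ne: "{vs ! k, vs ! i} \<noteq> {vs ! i, vs ! ?l}" by (auto simp: doubleton_eq_iff)
    have in1: "{vs ! k, vs ! i} \<in> {e \<in> F. vs ! i \<in> e}" using edge[OF k(1)] k(2) by simp
    have in2: "{vs ! i, vs ! ?l} \<in> {e \<in> F. vs ! i \<in> e}" using edge[OF i(1)] by simp
    have "card {e \<in> F. vs ! i \<in> e} = 2" using F in1 by (auto simp: two_regular_def)
    then have "{{vs ! k, vs ! i}, {vs ! i, vs ! ?l}} = {e \<in> F. vs ! i \<in> e}"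
      using in1 in2 ne by (intro card_subset_eq) (auto intro: card_ge_0_finite)
    then have "f \<in> {{vs ! k, vs ! i}, {vs ! i, vs ! ?l}}" using f(1) i(2) by blast
    then show ?thesis using i(1) k(1) l by auto
  qed
  then show thesis using that cyc by blast
qed

lemma two_regular_remove:
  assumes F: "two_regular F" and W: "\<And>e. e \<in> F \<Longrightarrow> e \<inter> W \<noteq> {} \<Longrightarrow> e \<subseteq> W"
  shows "two_regular {e \<in> F. e \<inter> W = {}}"
proof -
  have "{e \<in> {e \<in> F. e \<inter> W = {}}. v \<in> e} = {e \<in> F. v \<in> e}" if "v \<in> \<Union>{e \<in> F. e \<inter> W = {}}" for v
    using that W by blast
  then show ?thesis using F unfolding two_regular_def by auto
qed

text \<open>No edge leaves \<open>W\<close>, so the edges inside it contribute the indicator vector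
  of \<open>W\<close> and the remaining edges are unaffected.\<close>

lemma component_combination:
  assumes F: "finite F" "\<And>e. e \<in> F \<Longrightarrow> finite e" and W: "finite W" "W \<subseteq> \<Union>F"
    "\<And>e. e \<in> F \<Longrightarrow> e \<inter> W \<noteq> {} \<Longrightarrow> e \<subseteq> W"
    and one: "\<And>v. v \<in> W \<Longrightarrow> (\<Sum>e\<in>{e \<in> F. v \<in> e}. c e) = 1"
  shows "(\<Sum>e\<in>F. c e *\<^sub>R edge_vector e) =
    (\<Sum>i\<in>W. Poly_Mapping.single i 1) + (\<Sum>e\<in>{e \<in> F. e \<inter> W = {}}. c e *\<^sub>R edge_vector e)"
proof (rule poly_mapping_eqI)
  fix v
  have "(\<Sum>e\<in>{e \<in> F. v \<in> e}. c e) = (if v \<in> W then 1 else 0) + (\<Sum>e\<in>{e \<in> {e \<in> F. e \<inter> W =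
    {}}. v \<in> e}. c e)"
  proof (cases "v \<in> W")
    case True
    then have "{e \<in> {e \<in> F. e \<inter> W = {}}. v \<in> e} = {}" by blast
    then show ?thesis using one[OF True] True by (simp only: sum.empty) simp
  next
    case False
    then have "{e \<in> {e \<in> F. e \<inter> W = {}}. v \<in> e} = {e \<in> F. v \<in> e}" using W(3) by blast
    then show ?thesis using False by simp
  qed
  then show "Poly_Mapping.lookup (\<Sum>e\<in>F. c e *\<^sub>R edge_vector e) v =
    Poly_Mapping.lookup ((\<Sum>i\<in>W. Poly_Mapping.single i 1) +
      (\<Sum>e\<in>{e \<in> F. e \<inter> W = {}}. c e *\<^sub>R edge_vector e)) v"
    using F W(1) lookup_edge_combination[of "{e \<in> F. e \<inter> W = {}}" c v]
    by (simp add: lookup_add lookup_sum_single lookup_edge_combination)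
qed

lemma graph_on_finite: "graph_on d E \<Longrightarrow> finite E"
  by (rule finite_subset[of _ "Pow {1..d}"]) (auto simp: graph_on_def)

lemma graph_on_edge: "graph_on d E \<Longrightarrow> e \<in> E \<Longrightarrow> card e = 2 \<and> finite e \<and> e \<subseteq> {1..d}"
  by (metis card.infinite graph_on_def zero_neq_numeral)

lemma half_total_edge: "graph_on d E \<Longrightarrow> e \<in> E \<Longrightarrow> half_total d (edge_vector e) = 1"
  using graph_on_edge[of d E e] by (simp add: edge_vector_def half_total_sum_single)

lemma even_lattice_diff: "x \<in> even_lattice d \<Longrightarrow> y \<in> even_lattice d \<Longrightarrow> x - y \<in> even_lattice d"
  by (auto simp: even_lattice_def lookup_minus linear_diff[OF linear_half_total])

lemma edge_in_even_lattice: "graph_on d E \<Longrightarrow> e \<in> E \<Longrightarrow> edge_vector e \<in> even_lattice d"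
  using graph_on_edge[of d E e] by (simp add: even_lattice_def half_total_edge lookup_edge_vector)

lemma edge_vector_sums_in_even_lattice:
  assumes "graph_on d E" "x \<in> edge_vector_sums E" shows "x \<in> even_lattice d"
proof -
  have "sum_list (map edge_vector es) \<in> even_lattice d" if "set es \<subseteq> E" for es
    using that
  proof (induction es)
    case Nil
    then show ?case by (simp add: even_lattice_def half_total_def)
  next
    case (Cons e es)
    have "edge_vector e \<in> even_lattice d" using Cons edge_in_even_lattice[OF assms(1)] by simp
    moreover have "0 \<in> even_lattice d" by (simp add: even_lattice_def half_total_def)
    ultimately show ?case
      using even_lattice_diff[of "edge_vector e" d "0 - sum_list (map edge_vector es)"]
        even_lattice_diff[of 0 d "sum_list (map edge_vector es)"] Cons by simp
  qed
  then show ?thesis using assms(2) by (auto simp: edge_vector_sums_def)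
qed

text \<open>By integrality each vertex meets at least two edges of \<open>F\<close>, while independence bounds the number
  of edges by the number of vertices.\<close>

lemma small_support_two_regular:
  assumes F: "finite F" "\<And>e. e \<in> F \<Longrightarrow> card e = 2 \<and> finite e" "inj_on edge_vector F"
    "independent (edge_vector ` F)"
    and c: "\<And>e. e \<in> F \<Longrightarrow> 0 < c e \<and> c e < (1::real)"
    and int: "\<And>v. (\<Sum>e\<in>{e \<in> F. v \<in> e}. c e) \<in> \<int>"
  shows "two_regular F" and "\<And>v. v \<in> \<Union>F \<Longrightarrow> (\<Sum>e\<in>{e \<in> F. v \<in> e}. c e) = 1"
proof -
  let ?deg = "\<lambda>v. card {e \<in> F. v \<in> e}"
  have finV: "finite (\<Union>F)" using F(1,2) by blast
  have ge2: "2 \<le> ?deg v" if "v \<in> \<Union>F" for v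
  proof (rule ccontr)
    assume "\<not> 2 \<le> ?deg v"
    moreover have "{e \<in> F. v \<in> e} \<noteq> {}" using that by blast
    then have "?deg v \<noteq> 0" using F(1) by simp
    ultimately have "?deg v = 1" by linarith
    then obtain e where e: "{e \<in> F. v \<in> e} = {e}" by (auto simp: card_1_singleton_iff)
    then have "c e \<in> \<int>" using int[of v] by simp
    moreover have "e \<in> F" using e by blast
    ultimately show False using c[of e] by (auto simp: Ints_def)
  qed
  have "card (edge_vector ` F) \<le> card ((\<lambda>v. Poly_Mapping.single v (1::real)) ` \<Union>F)"
  proof (rule independent_span_bound[OF _ F(4), THEN conjunct2])
    have "edge_vector e \<in> span ((\<lambda>v. Poly_Mapping.single v 1) ` \<Union>F)" if "e \<in> F" for e
      unfolding edge_vector_def by (intro span_sum span_base imageI) (use that in blast)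
    then show "edge_vector ` F \<subseteq> span ((\<lambda>v. Poly_Mapping.single v 1) ` \<Union>F)" by blast
  qed (use finV in simp)
  then have le: "card F \<le> card (\<Union>F)"
    using card_image[OF F(3)] card_image_le[OF finV, of "\<lambda>v. Poly_Mapping.single v (1::real)"]
      by linarith
  \<comment> \<open>Double counting of incidences: the degrees sum to twice the number of edges,
    hence to at most twice the number of vertices, and so none of them exceeds 2.\<close>
  have "(\<Sum>v\<in>\<Union>F. ?deg v) = (\<Sum>v\<in>\<Union>F. \<Sum>e\<in>F. if v \<in> e then 1 else 0)"
    using F(1) by (simp add: sum.If_cases Int_def)
  also have "\<dots> = (\<Sum>e\<in>F. \<Sum>v\<in>\<Union>F. if v \<in> e then 1 else 0)" by (rule sum.swap)
  also have "\<dots> = (\<Sum>e\<in>F. 2)"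
  proof (rule sum.cong[OF refl])
    fix e assume e: "e \<in> F"
    then have "\<Union>F \<inter> {v. v \<in> e} = e" by blast
    then show "(\<Sum>v\<in>\<Union>F. if v \<in> e then 1 else 0) = (2::nat)"
      using F(2)[OF e] finV by (simp add: sum.If_cases)
  qed
  finally have sum: "(\<Sum>v\<in>\<Union>F. ?deg v) \<le> (\<Sum>v\<in>\<Union>F. 2)" using le by simp
  have eq2: "?deg v = 2" if "v \<in> \<Union>F" for v
  proof (rule ccontr)
    assume "?deg v \<noteq> 2"
    then have "2 < ?deg v" using ge2[OF that] by linarith
    then have "(\<Sum>v\<in>\<Union>F. 2) < (\<Sum>v\<in>\<Union>F. ?deg v)"
      using ge2 that by (intro sum_strict_mono_ex1 finV) auto
    then show False using sum by linarith
  qed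
  then show "two_regular F" using F(1,2) by (auto simp: two_regular_def)
  fix v assume "v \<in> \<Union>F"
  then have "card {e \<in> F. v \<in> e} = 2" by (rule eq2)
  then obtain e f where ef: "{e \<in> F. v \<in> e} = {e, f}" "e \<noteq> f"
    unfolding card_2_iff by blast
  then have "e \<in> F" "f \<in> F" by blast+
  then have "0 < c e + c f" "c e + c f < 2" using c[of e] c[of f] by auto
  moreover have "c e + c f \<in> \<int>" using int[of v] ef by simp
  ultimately have "c e + c f = 1" by (auto elim!: Ints_cases)
  then show "(\<Sum>e\<in>{e \<in> F. v \<in> e}. c e) = 1" using ef by simp
qed

text \<open>The support of a point is made independent by Caratheodory's theorem. Once no coefficient
  reaches 1, it is a disjoint union of cycles; an even one, or two odd ones joined by an edge, have
  perfectly matchable vertex sets.\<close>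

theorem even_lattice_cone_subset:
  assumes G: "graph_on d E" and occ: "odd_cycle_condition E"
  shows "even_lattice d \<inter> fcone (edge_vector ` E) \<subseteq> edge_vector_sums E"
proof
  fix x assume "x \<in> even_lattice d \<inter> fcone (edge_vector ` E)"
  then show "x \<in> edge_vector_sums E"
  \<comment> \<open>The degree of a lattice point of the cone is a nonnegative integer, so
    \<open>nat\<close> and the floor merely change its type.\<close>
  proof (induction "nat \<lfloor>half_total d x\<rfloor>" arbitrary: x rule: less_induct)
    case less
    let ?one = "\<lambda>W. \<Sum>i\<in>W. Poly_Mapping.single i (1::real)"
    have E: "finite E" "\<And>e. e \<in> E \<Longrightarrow> card e = 2 \<and> finite e \<and> e \<subseteq> {1..d}"
      using graph_on_finite[OF G] graph_on_edge[OF G] by auto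
    have ge0: "0 \<le> half_total d y" if "y \<in> fcone (edge_vector ` E)" for y
      using that half_total_edge[OF G]
      by (auto simp: fcone_def linear_sum[OF linear_half_total] linear_cmul[OF linear_half_total]
        intro!: sum_nonneg)
    \<comment> \<open>The induction step: it suffices to split off any sum of edges of positive
      degree whose removal stays in the cone.\<close>
    have reduce: ?case if y: "y \<in> edge_vector_sums E" "x - y \<in> fcone (edge_vector ` E)"
      "0 < half_total d y" for y
    proof -
      have "x - y \<in> even_lattice d"
        using less(2) y(1) edge_vector_sums_in_even_lattice[OF G] even_lattice_diff by blast
      moreover have "nat \<lfloor>half_total d (x - y)\<rfloor> < nat \<lfloor>half_total d x\<rfloor>"
      proof -
        have "half_total d (x - y) < half_total d x" using y(3)
          by (simp add: linear_diff[OF linear_half_total])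
        moreover have "half_total d (x - y) \<in> \<int>" "half_total d x \<in> \<int>"
          using \<open>x - y \<in> even_lattice d\<close> less(2) by (auto simp: even_lattice_def)
        ultimately show ?thesis using ge0[OF y(2)] by (auto elim!: Ints_cases)
      qed
      ultimately have "x - y \<in> edge_vector_sums E" using less(1) y(2) by blast
      then show ?thesis using edge_vector_sums_add[OF y(1)] by fastforce
    qed
    obtain T c0 where T: "T \<subseteq> edge_vector ` E" "independent T" "\<forall>a\<in>T. 0 < c0 a" "x = (\<Sum>a\<in>T. c0 a *\<^sub>R a)"
      using fcone_caratheodory[of "edge_vector ` E" x] E(1) less(2) by blast
    then obtain F where F: "F \<subseteq> E" "T = edge_vector ` F" by (meson subset_image_iff)
    have inj: "inj_on edge_vector F" using F(1) E(2) edge_vector_inj by (meson inj_onI subsetD)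
    define c where "c e = c0 (edge_vector e)" for e
    have x: "x = (\<Sum>e\<in>F. c e *\<^sub>R edge_vector e)" and cpos: "\<And>e. e \<in> F \<Longrightarrow> 0 < c e"
      using T F inj by (auto simp: c_def sum.reindex)
    have fin: "finite F" "\<And>e. e \<in> F \<Longrightarrow> finite e" using F E finite_subset by auto
    \<comment> \<open>Coefficients indexed by edges are turned into coefficients indexed by vectors;
      this needs \<open>edge_vector\<close> to be injective.\<close>
    have in_cone: "(\<Sum>e\<in>H. c' e *\<^sub>R edge_vector e) \<in> fcone (edge_vector ` E)"
      if "H \<subseteq> F" "\<And>e. e \<in> H \<Longrightarrow> 0 \<le> c' e" for H c'
    proof -
      have "inj_on edge_vector H" using inj that(1) inj_on_subset by blast
      then have "(\<Sum>e\<in>H. c' e *\<^sub>R edge_vector e) = (\<Sum>a\<in>edge_vector ` H. c' (the_inv_into H edge_vector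
        a) *\<^sub>R a)"
        by (simp add: sum.reindex the_inv_into_f_f)
      also have "\<dots> \<in> fcone (edge_vector ` H)"
        using \<open>inj_on edge_vector H\<close> that(2) by (intro fconeI) (auto simp: the_inv_into_f_f)
      finally show ?thesis using fcone_mono[of "edge_vector ` E" "edge_vector ` H"] E(1) F(1) that(1)
        by blast
    qed
    show ?case
    proof (cases "\<exists>e\<in>F. 1 \<le> c e")
      case True
      then obtain e where e: "e \<in> F" "1 \<le> c e" by blast
      have "x - edge_vector e = (\<Sum>f\<in>F. (c f - (if f = e then 1 else 0)) *\<^sub>R edge_vector f)"
      proof -
        have "(\<Sum>f\<in>F. (if f = e then 1 else 0) *\<^sub>R edge_vector f) = (\<Sum>f\<in>F.
          if f = e then edge_vector f else 0)"
          by (intro sum.cong) auto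
        then show ?thesis using fin(1) e(1) by (simp add: x scaleR_diff_left sum_subtractf)
      qed
      moreover have "0 \<le> c f - (if f = e then 1 else 0)" if "f \<in> F" for f
        using cpos[OF that] e by auto
      ultimately have "x - edge_vector e \<in> fcone (edge_vector ` E)" using in_cone[OF order_refl] by simp
      moreover have "e \<in> E" using e F by blast
      ultimately show ?thesis
        using reduce[of "edge_vector e"] edge_vector_sums_edge half_total_edge[OF G] by simp
    next
      case False
      then have c01: "0 < c e \<and> c e < 1" if "e \<in> F" for e using cpos that by force
      have lx: "Poly_Mapping.lookup x v = (\<Sum>e\<in>{e \<in> F. v \<in> e}. c e)" for v
        unfolding x by (rule lookup_edge_combination[OF fin])
      have "Poly_Mapping.lookup x v \<in> \<int>" for v using less(2) by (simp add: even_lattice_def)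
      then have int: "(\<Sum>e\<in>{e \<in> F. v \<in> e}. c e) \<in> \<int>" for v by (simp add: lx)
      have F2: "\<And>e. e \<in> F \<Longrightarrow> card e = 2 \<and> finite e" using F(1) E(2) by blast
      have ind: "independent (edge_vector ` F)" using T(2) F(2) by simp
      note reg = small_support_two_regular[OF fin(1) F2 inj ind c01 int]
      have VF: "\<Union>F \<subseteq> {1..d}" using F(1) E(2) by blast
      have cE: "graph_cycle E vs" "set vs \<subseteq> \<Union>F" "0 < card (set vs)" if "graph_cycle F vs" for vs
        using graph_cycle_mono[OF that F(1)] graph_cycle_vertices[OF that] by auto
      have split: "(\<Sum>e\<in>H. c e *\<^sub>R edge_vector e) = ?one W + (\<Sum>e\<in>{e \<in> H. e \<inter> W =
        {}}. c e *\<^sub>R edge_vector e)"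
        if "H \<subseteq> F" "W \<subseteq> \<Union>H" "\<And>e. e \<in> F \<Longrightarrow> e \<inter> W \<noteq> {} \<Longrightarrow> e \<in> H \<and> e \<subseteq> W" for H W
      proof (rule component_combination)
        show "finite H" "\<And>e. e \<in> H \<Longrightarrow> finite e" using that(1) fin finite_subset by auto
        show "finite W" using that(1,2) VF finite_subset[of W "{1..d}"] by blast
        fix v assume "v \<in> W"
        then have "{e \<in> H. v \<in> e} = {e \<in> F. v \<in> e}" using that(1,3) by blast
        moreover have "v \<in> \<Union>F" using \<open>v \<in> W\<close> that(1,2) by blast
        ultimately show "(\<Sum>e\<in>{e \<in> H. v \<in> e}. c e) = 1" using reg(2) by simp
      qed (use that in auto)
      have even: ?thesis if vs: "graph_cycle F vs" "\<And>e. e \<in> F \<Longrightarrow> e \<inter> set vs \<noteq> {} \<Longrightarrow> e \<subseteq> set vs"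
        "even (length vs)" for vs
      proof (rule reduce)
        show "0 < half_total d (?one (set vs))"
          using half_total_sum_single[OF subset_trans[OF cE(2)[OF vs(1)] VF]] cE(3)[OF vs(1)] by simp
        show "?one (set vs) \<in> edge_vector_sums E"
          using even_cycle_in_edge_vector_sums[OF _ cE(1)[OF vs(1)] vs(3)] E(2) by blast
        have "x - ?one (set vs) = (\<Sum>e\<in>{e \<in> F. e \<inter> set vs = {}}. c e *\<^sub>R edge_vector e)"
          using split[of F "set vs"] cE(2)[OF vs(1)] vs(2) by (simp add: x)
        then show "x - ?one (set vs) \<in> fcone (edge_vector ` E)"
          using in_cone[of "{e \<in> F. e \<inter> set vs = {}}" c] cpos by (auto simp: less_imp_le)
      qed
      show ?thesis
      proof (cases "F = {}")
        case True
        then show ?thesis using x edge_vector_sums_zero by simp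
      next
        case False
        then obtain vs where vs: "graph_cycle F vs" "\<And>e. e \<in> F \<Longrightarrow> e \<inter> set vs \<noteq> {} \<Longrightarrow> e \<subseteq> set vs"
          using two_regular_cycle[OF reg(1)] by blast
        define H where "H = {e \<in> F. e \<inter> set vs = {}}"
        have xH: "x = ?one (set vs) + (\<Sum>e\<in>H. c e *\<^sub>R edge_vector e)"
          unfolding H_def x using split[of F "set vs"] cE(2)[OF vs(1)] vs(2) by simp
        show ?thesis
        proof (cases "even (length vs)")
          case True
          then show ?thesis using even vs by blast
        next
          case odd: False
          have dvs: "card (set vs) = length vs" using vs(1) distinct_card
            by (auto simp: graph_cycle_def)
          \<comment> \<open>A single odd cycle would have half-integral degree, contrary to
            membership in the even lattice; hence there is a second cycle.\<close>
          have "H \<noteq> {}"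
          proof
            assume "H = {}"
            then have total: "half_total d x = length vs / 2"
              using xH half_total_sum_single[of "set vs" d] cE(2)[OF vs(1)] VF dvs by simp
            have "half_total d x \<in> \<int>" using less(2) by (simp add: even_lattice_def)
            then obtain z where "half_total d x = real_of_int z" by (rule Ints_cases)
            then have "int (length vs) = 2 * z" using total by linarith
            then show False using odd by presburger
          qed
          then obtain us where us: "graph_cycle H us" "\<And>e. e \<in> H \<Longrightarrow> e \<inter> set us \<noteq> {} \<Longrightarrow> e \<subseteq> set us"
            using two_regular_cycle[OF two_regular_remove[OF reg(1) vs(2)]] unfolding H_def by blast
          have usF: "graph_cycle F us" using graph_cycle_mono[OF us(1)] by (simp add: H_def)
          have usH: "set us \<subseteq> \<Union>H" by (rule graph_cycle_vertices[OF us(1)])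
          then have disj: "set vs \<inter> set us = {}" unfolding H_def by blast
          have usc: "e \<in> H \<and> e \<subseteq> set us" if "e \<in> F" "e \<inter> set us \<noteq> {}" for e
          proof -
            have "e \<in> H" using that vs(2)[OF that(1)] disj unfolding H_def by blast
            then show ?thesis using us(2) that by blast
          qed
          show ?thesis
          proof (cases "even (length us)")
            case True
            then show ?thesis using even[OF usF] usc by blast
          next
            case odd': False
            have oc: "odd_cycle E vs" "odd_cycle E us" using odd odd' cE(1) vs(1) usF
              by (auto simp: odd_cycle_def)
            then obtain v u where vu: "v \<in> set vs" "u \<in> set us" "{v, u} \<in> E"
              using occ disj unfolding odd_cycle_condition_def by blast
            show ?thesis
            proof (rule reduce)
              show "?one (set vs) + ?one (set us) \<in> edge_vector_sums E"
                using odd_cycle_pair_in_edge_vector_sums[OF _ oc vu] E(2) by blast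
              show "0 < half_total d (?one (set vs) + ?one (set us))"
                using half_total_sum_single[OF subset_trans[OF cE(2)[OF vs(1)] VF]] cE(3)[OF vs(1)]
                  half_total_sum_single[OF subset_trans[OF cE(2)[OF usF] VF]]
                by (simp only: linear_add[OF linear_half_total])
              have "x - (?one (set vs) + ?one (set us)) = (\<Sum>e\<in>{e \<in> H. e \<inter> set us =
                {}}. c e *\<^sub>R edge_vector e)"
                using split[of H "set us"] usH usc xH by (auto simp: H_def)
              then show "x - (?one (set vs) + ?one (set us)) \<in> fcone (edge_vector ` E)"
                using in_cone[of "{e \<in> H. e \<inter> set us = {}}" c] cpos by (auto simp: less_imp_le H_def)
            qed
          qed
        qed
      qed
    qed
  qed
qed

section \<open>The edge ring and its Hilbert function\<close>

definition edge_exponent :: "nat set \<Rightarrow> (nat \<Rightarrow>\<^sub>0 nat)" where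
  "edge_exponent e = (\<Sum>i\<in>e. Poly_Mapping.single i 1)"

definition edge_exponents :: "edges \<Rightarrow> nat \<Rightarrow> (nat \<Rightarrow>\<^sub>0 nat) set" where
  "edge_exponents E n = {sum_list (map edge_exponent es) | es. set es \<subseteq> E \<and> length es = n}"

text \<open>The degree filtration. Elements chosen along a chain of primes need not be homogeneous,
  so growth is measured here instead of in one component.\<close>

definition exponents_upto :: "edges \<Rightarrow> nat \<Rightarrow> (nat \<Rightarrow>\<^sub>0 nat) set" where
  "exponents_upto E n = (\<Union>k\<le>n. edge_exponents E k)"

lemma edge_monomial_eq: "edge_monomial e = (Poly_Mapping.single (edge_exponent e) 1 :: 'k::field mpoly)"
proof -
  have "(\<Prod>i\<in>e. mpoly_var i) = (Poly_Mapping.single (\<Sum>i\<in>e. Poly_Mapping.single i 1) 1 :: 'k mpoly)"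
    by (induction e rule: infinite_finite_induct) (auto simp: mpoly_var_def mult_single)
  then show ?thesis by (simp add: edge_monomial_def edge_exponent_def)
qed

lemma prod_edge_monomials:
  "prod_list (map edge_monomial es) = (Poly_Mapping.single (sum_list (map edge_exponent es)) 1 ::
    'k::field mpoly)"
  by (induction es) (auto simp: edge_monomial_eq mult_single)

lemma edge_exponents_add:
  "a \<in> edge_exponents E m \<Longrightarrow> b \<in> edge_exponents E n \<Longrightarrow> a + b \<in> edge_exponents E (m + n)"
  unfolding edge_exponents_def
  by clarify (rename_tac es fs, rule_tac x = "es @ fs" in exI, simp)

lemma edge_exponents_zero: "0 \<in> edge_exponents E 0"
  unfolding edge_exponents_def by (auto intro!: exI[of _ "[]"])

lemma edge_exponents_one: "e \<in> E \<Longrightarrow> edge_exponent e \<in> edge_exponents E 1"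
  unfolding edge_exponents_def by (auto intro!: exI[of _ "[e]"])

lemma finite_edge_exponents:
  assumes "finite E" shows "finite (edge_exponents E n)"
proof -
  have "edge_exponents E n = (\<lambda>es. sum_list (map edge_exponent es)) ` {es. set es \<subseteq> E \<and> length es = n}"
    by (auto simp: edge_exponents_def)
  then show ?thesis using finite_lists_length_eq[OF assms] by simp
qed

lemma exponents_upto_add:
  "a \<in> exponents_upto E m \<Longrightarrow> b \<in> exponents_upto E n \<Longrightarrow> a + b \<in> exponents_upto E (m + n)"
  unfolding exponents_upto_def using edge_exponents_add[of a E _ b]
  by (metis (no_types, lifting) UN_iff add_mono atMost_iff)

lemma exponents_upto_mono: "m \<le> n \<Longrightarrow> exponents_upto E m \<subseteq> exponents_upto E n"
  by (force simp: exponents_upto_def)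

lemma poly_mapping_sum_singles:
  fixes p :: "'a \<Rightarrow>\<^sub>0 'k::comm_monoid_add"
  assumes "finite K" "Poly_Mapping.keys p \<subseteq> K"
  shows "p = (\<Sum>m\<in>K. Poly_Mapping.single m (Poly_Mapping.lookup p m))"
proof (rule poly_mapping_eqI)
  fix k
  have "Poly_Mapping.lookup (\<Sum>m\<in>K. Poly_Mapping.single m (Poly_Mapping.lookup p m)) k = (\<Sum>m\<in>K.
    if m = k then Poly_Mapping.lookup p k else 0)"
    unfolding lookup_sum by (intro sum.cong) (auto simp: lookup_single when_def)
  then show "Poly_Mapping.lookup p k = Poly_Mapping.lookup (\<Sum>m\<in>K. Poly_Mapping.single m
    (Poly_Mapping.lookup p m)) k"
    using assms by (auto simp: not_in_keys_iff_lookup_eq_zero)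
qed

lemma mpoly_scale_single: "mpoly_scale c (Poly_Mapping.single m 1) = Poly_Mapping.single m c"
  by (simp add: mpoly_scale_def mpoly_const_def mult_single)

lemma keys_mpoly_scale: "Poly_Mapping.keys (mpoly_scale c p) \<subseteq> Poly_Mapping.keys p"
  using keys_mult[of "mpoly_const c" p] by (auto simp: mpoly_scale_def mpoly_const_def split: if_splits)

lemma span_monomials:
  "mpoly.span ((\<lambda>m. Poly_Mapping.single m 1) ` K) = {p :: 'k::field mpoly. Poly_Mapping.keys p \<subseteq> K}"
proof
  have "mpoly.subspace {p :: 'k mpoly. Poly_Mapping.keys p \<subseteq> K}"
  proof (rule mpoly.subspaceI)
    show "p + q \<in> {p. Poly_Mapping.keys p \<subseteq> K}"
      if "p \<in> {p. Poly_Mapping.keys p \<subseteq> K}" "q \<in> {p. Poly_Mapping.keys p \<subseteq> K}" for p q :: "'k mpoly"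
      using that keys_add[of p q] by blast
    show "mpoly_scale c p \<in> {p. Poly_Mapping.keys p \<subseteq> K}" if "p \<in> {p. Poly_Mapping.keys p \<subseteq> K}" for c p
      using that keys_mpoly_scale[of c p] by blast
  qed simp
  then show "mpoly.span ((\<lambda>m. Poly_Mapping.single m 1) ` K) \<subseteq> {p :: 'k mpoly. Poly_Mapping.keys p \<subseteq> K}"
    by (intro mpoly.span_minimal) auto
  show "{p :: 'k mpoly. Poly_Mapping.keys p \<subseteq> K} \<subseteq> mpoly.span ((\<lambda>m. Poly_Mapping.single m 1) ` K)"
  proof
    fix p :: "'k mpoly" assume p: "p \<in> {p. Poly_Mapping.keys p \<subseteq> K}"
    have "(\<Sum>m\<in>Poly_Mapping.keys p. Poly_Mapping.single m (Poly_Mapping.lookup p m)) \<in> mpoly.span ((\<lambda>m.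
      Poly_Mapping.single m 1) ` K)"
    proof (rule mpoly.span_sum)
      fix m assume m: "m \<in> Poly_Mapping.keys p"
      show "Poly_Mapping.single m (Poly_Mapping.lookup p m) \<in>
          mpoly.span ((\<lambda>m. Poly_Mapping.single m 1) ` K)"
        unfolding mpoly_scale_single[symmetric, of m "Poly_Mapping.lookup p m"]
        using m p by (intro mpoly.span_scale mpoly.span_base) auto
    qed
    then show "p \<in> mpoly.span ((\<lambda>m. Poly_Mapping.single m 1) ` K)"
      using poly_mapping_sum_singles[of "Poly_Mapping.keys p" p] by simp
  qed
qed

lemma independent_monomials: "mpoly.independent ((\<lambda>m. Poly_Mapping.single m 1 :: 'k::field mpoly) ` K)"
proof -
  have "p \<notin> mpoly.span ((\<lambda>m. Poly_Mapping.single m 1) ` K - {p})"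
    if p: "p \<in> (\<lambda>m. Poly_Mapping.single m 1) ` K" for p :: "'k mpoly"
  proof -
    obtain m where m: "m \<in> K" "p = Poly_Mapping.single m 1" using p by blast
    have inj: "inj (\<lambda>m. Poly_Mapping.single m 1 :: 'k mpoly)"
      by (rule injI) (metis keys_single singleton_inject zero_neq_one)
    have "(\<lambda>m. Poly_Mapping.single m 1) ` K - {p} = (\<lambda>m. Poly_Mapping.single m (1::'k)) ` (K - {m})"
      using image_set_diff[OF inj, of K "{m}"] m by simp
    then show ?thesis using m(2) by (simp add: span_monomials)
  qed
  then show ?thesis unfolding mpoly.dependent_def by blast
qed

lemma edge_ring_component_eq:
  "edge_ring_component E n = {p :: 'k::field mpoly. Poly_Mapping.keys p \<subseteq> edge_exponents E n}"
proof -
  have "{prod_list (map edge_monomial es) | es. set es \<subseteq> E \<and> length es = n} =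
    (\<lambda>m. Poly_Mapping.single m (1::'k)) ` edge_exponents E n"
    unfolding prod_edge_monomials edge_exponents_def by blast
  then show ?thesis by (simp add: edge_ring_component_def span_monomials)
qed

lemma dim_edge_ring_component:
  "vector_space.dim mpoly_scale (edge_ring_component E n :: 'k::field mpoly set) =
    card (edge_exponents E n)"
proof -
  have inj: "inj_on (\<lambda>m. Poly_Mapping.single m 1 :: 'k mpoly) (edge_exponents E n)"
    by (rule inj_onI) (metis keys_single singleton_inject zero_neq_one)
  have "mpoly.dim (mpoly.span ((\<lambda>m. Poly_Mapping.single m 1 :: 'k mpoly) ` edge_exponents E n)) =
    card (edge_exponents E n)"
    using mpoly.dim_span_eq_card_independent[OF independent_monomials] card_image[OF inj] by metis
  then show ?thesis by (simp add: span_monomials edge_ring_component_eq)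
qed

lemma edge_ring_simps:
  "p \<otimes>\<^bsub>edge_ring E\<^esub> q = p * q" "p \<oplus>\<^bsub>edge_ring E\<^esub> q = p + q"
  "\<one>\<^bsub>edge_ring E\<^esub> = 1" "\<zero>\<^bsub>edge_ring E\<^esub> = 0"
  by (simp_all add: edge_ring_def ring_of_type_algebra_def)

lemma cring_edge_ring: "cring (edge_ring E :: 'k::field mpoly ring)"
proof -
  interpret A: cring "ring_of_type_algebra :: 'k mpoly ring" by (rule cring_from_type_algebra)
  have "ring (edge_ring E :: 'k mpoly ring)"
    unfolding edge_ring_def by (rule A.generate_ring_is_ring) (simp add: ring_of_type_algebra_def)
  then interpret R: ring "edge_ring E :: 'k mpoly ring" .
  show ?thesis
    by unfold_locales (simp add: edge_ring_simps mult.commute)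
qed

text \<open>Replaces the generated subring by a condition on supports, which makes membership
  checkable one monomial at a time.\<close>

lemma carrier_edge_ring:
  "carrier (edge_ring E) = {p :: 'k::field mpoly. Poly_Mapping.keys p \<subseteq> (\<Union>n. edge_exponents E n)}"
proof
  interpret A: cring "ring_of_type_algebra :: 'k mpoly ring" by (rule cring_from_type_algebra)
  let ?R = "ring_of_type_algebra :: 'k mpoly ring"
  let ?S = "\<Union>n. edge_exponents E n"
  let ?G = "range mpoly_const \<union> edge_monomial ` E :: 'k mpoly set"
  have ops: "x \<otimes>\<^bsub>?R\<^esub> y = x * y" "x \<oplus>\<^bsub>?R\<^esub> y = x + y" "\<one>\<^bsub>?R\<^esub> = 1" "\<zero>\<^bsub>?R\<^esub> = 0" "carrier ?R = UNIV" for x y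
    by (simp_all add: ring_of_type_algebra_def)
  have neg: "\<ominus>\<^bsub>?R\<^esub> x = - x" for x
    using A.minus_equality[of "- x" x] by (simp add: ops)
  have S0: "0 \<in> ?S" using edge_exponents_zero by blast
  have Sadd: "a + b \<in> ?S" if "a \<in> ?S" "b \<in> ?S" for a b using that edge_exponents_add by blast
  have carr: "carrier (edge_ring E) = generate_ring ?R ?G" by (simp add: edge_ring_def)
  have "Poly_Mapping.keys p \<subseteq> ?S" if "p \<in> generate_ring ?R ?G" for p
    using that
  proof induction
    case (incl p)
    have "edge_exponent e \<in> ?S" if "e \<in> E" for e using edge_exponents_one[OF that] by blast
    then show ?case using S0 incl
      by (auto simp only: mpoly_const_def edge_monomial_eq keys_single split: if_splits)
  next
    case (a_inv p)
    then show ?case by (simp add: neg)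
  next
    case (eng_add p q)
    then show ?case using keys_add[of p q] by (auto simp: ops)
  next
    case (eng_mult p q)
    have "m \<in> ?S" if m: "m \<in> Poly_Mapping.keys (p * q)" for m
    proof -
      obtain a b where "m = a + b" "a \<in> Poly_Mapping.keys p" "b \<in> Poly_Mapping.keys q"
        using m keys_mult[of p q] by blast
      then show ?thesis using Sadd[of a b] eng_mult by blast
    qed
    then show ?case unfolding ops by blast
  qed (use S0 in \<open>auto simp: ops\<close>)
  then show "carrier (edge_ring E) \<subseteq> {p :: 'k mpoly. Poly_Mapping.keys p \<subseteq> ?S}" by (auto simp: carr)
  have const: "mpoly_const c \<in> generate_ring ?R ?G" for c by (rule generate_ring.incl) simp
  have prod: "prod_list (map edge_monomial es) \<in> generate_ring ?R ?G" if "set es \<subseteq> E" for es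
    using that
  proof (induction es)
    case Nil
    then show ?case using generate_ring.one[of ?R ?G] by (simp add: ops)
  next
    case (Cons e es)
    have "edge_monomial e \<in> generate_ring ?R ?G" using Cons by (intro generate_ring.incl) auto
    then show ?case using generate_ring.eng_mult[of "edge_monomial e" ?R ?G] Cons by (simp add: ops)
  qed
  have sums: "(\<Sum>i\<in>I. f i) \<in> generate_ring ?R ?G" if "\<And>i. i \<in> I \<Longrightarrow> f i \<in> generate_ring ?R ?G"
    for I :: "(nat \<Rightarrow>\<^sub>0 nat) set" and f
    using that
  proof (induction I rule: infinite_finite_induct)
    case (insert i I)
    then show ?case using generate_ring.eng_add[of "f i" ?R ?G] by (simp add: ops)
  qed (use A.zero_in_generate in \<open>simp_all add: ops\<close>)
  show "{p :: 'k mpoly. Poly_Mapping.keys p \<subseteq> ?S} \<subseteq> carrier (edge_ring E)"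
  proof
    fix p :: "'k mpoly" assume p: "p \<in> {p. Poly_Mapping.keys p \<subseteq> ?S}"
    have "(\<Sum>m\<in>Poly_Mapping.keys p. Poly_Mapping.single m (Poly_Mapping.lookup p m)) \<in>
        generate_ring ?R ?G"
    proof (rule sums)
      fix m assume "m \<in> Poly_Mapping.keys p"
      then obtain es where es: "set es \<subseteq> E" "m = sum_list (map edge_exponent es)"
        using p unfolding edge_exponents_def by blast
      have "Poly_Mapping.single m (Poly_Mapping.lookup p m) = mpoly_const (Poly_Mapping.lookup p m) *
        prod_list (map edge_monomial es)"
        by (simp add: prod_edge_monomials es(2) mpoly_const_def mult_single)
      then show "Poly_Mapping.single m (Poly_Mapping.lookup p m) \<in> generate_ring ?R ?G"
        using generate_ring.eng_mult[OF const prod[OF es(1)]] by (simp add: ops)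
    qed
    then show "p \<in> carrier (edge_ring E)"
      using poly_mapping_sum_singles[of "Poly_Mapping.keys p" p] by (simp add: carr)
  qed
qed

lemma mpoly_const_in_edge_ring: "mpoly_const a \<in> carrier (edge_ring E)"
  using edge_exponents_zero by (auto simp: carrier_edge_ring mpoly_const_def)

text \<open>Restates the prime ideal axioms with the type class operations of the polynomial
  type.\<close>

locale edge_ring_prime =
  fixes E :: edges and P :: "'k::field mpoly set"
  assumes prime: "primeideal P (edge_ring E)"
begin

interpretation P: primeideal P "edge_ring E" by (rule prime)

lemma prime_add: "p \<in> P \<Longrightarrow> q \<in> P \<Longrightarrow> p + q \<in> P"
  using additive_subgroup.a_closed[OF P.is_additive_subgroup] by (simp add: edge_ring_simps)

lemma prime_mult: "p \<in> P \<Longrightarrow> q \<in> carrier (edge_ring E) \<Longrightarrow> q * p \<in> P"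
  using P.I_l_closed by (simp add: edge_ring_simps)

lemma prime_subset: "P \<subseteq> carrier (edge_ring E)"
  by (rule P.a_subset)

lemma prime_dvd: "p \<in> carrier (edge_ring E) \<Longrightarrow> q \<in> carrier (edge_ring E) \<Longrightarrow> p * q \<in> P \<Longrightarrow> p \<in> P \<or> q \<in> P"
  using P.I_prime by (simp add: edge_ring_simps)

lemma one_notin_prime: "1 \<notin> P"
  using P.I_notcarr P.one_imp_carrier by (auto simp: edge_ring_simps)

end

section \<open>Krull dimension\<close>

lemma edge_ring_closed:
  fixes p q :: "'k::field mpoly"
  shows "p \<in> carrier (edge_ring E) \<Longrightarrow> q \<in> carrier (edge_ring E) \<Longrightarrow> p + q \<in> carrier (edge_ring E)"
    and "p \<in> carrier (edge_ring E) \<Longrightarrow> q \<in> carrier (edge_ring E) \<Longrightarrow> p * q \<in> carrier (edge_ring E)"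
    and "(1 :: 'k mpoly) \<in> carrier (edge_ring E)" and "(0 :: 'k mpoly) \<in> carrier (edge_ring E)"
    and "p \<in> carrier (edge_ring E) \<Longrightarrow> - p \<in> carrier (edge_ring E)"
proof -
  interpret R: cring "edge_ring E :: 'k mpoly ring" by (rule cring_edge_ring)
  show "p \<in> carrier (edge_ring E) \<Longrightarrow> q \<in> carrier (edge_ring E) \<Longrightarrow> p + q \<in> carrier (edge_ring E)"
    using R.a_closed[of p q] by (simp add: edge_ring_simps)
  show "p \<in> carrier (edge_ring E) \<Longrightarrow> q \<in> carrier (edge_ring E) \<Longrightarrow> p * q \<in> carrier (edge_ring E)"
    using R.m_closed[of p q] by (simp add: edge_ring_simps)
  show "(1 :: 'k mpoly) \<in> carrier (edge_ring E)" "(0 :: 'k mpoly) \<in> carrier (edge_ring E)"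
    using R.one_closed R.zero_closed by (simp_all only: edge_ring_simps)
  show "p \<in> carrier (edge_ring E) \<Longrightarrow> - p \<in> carrier (edge_ring E)"
    by (simp add: carrier_edge_ring)
qed

lemma edge_ring_sum:
  fixes f :: "'i \<Rightarrow> 'k::field mpoly"
  shows "(\<And>i. i \<in> I \<Longrightarrow> f i \<in> carrier (edge_ring E)) \<Longrightarrow> (\<Sum>i\<in>I. f i) \<in> carrier (edge_ring E)"
  by (induction I rule: infinite_finite_induct) (auto intro: edge_ring_closed)

lemma edge_ring_power:
  fixes p :: "'k::field mpoly"
  shows "p \<in> carrier (edge_ring E) \<Longrightarrow> p ^ k \<in> carrier (edge_ring E)"
  by (induction k) (auto intro: edge_ring_closed)

section \<open>Upper bound for chains of primes\<close>

text \<open>The monomial in the elements \<open>xs\<close> with exponent vector \<open>ks\<close>.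
  Since \<open>map2\<close> truncates, equal lengths are imposed wherever it matters.\<close>

definition list_monomial :: "'a::comm_monoid_mult list \<Rightarrow> nat list \<Rightarrow> 'a" where
  "list_monomial xs ks = prod_list (map2 (\<lambda>x k. x ^ k) xs ks)"

lemma list_monomial_Nil [simp]: "list_monomial [] ks = 1"
  and list_monomial_Cons [simp]: "list_monomial (x # xs) (k # ks) = x ^ k * list_monomial xs ks"
  by (simp_all add: list_monomial_def)

lemma edge_ring_list_monomial:
  fixes xs :: "'k::field mpoly list"
  assumes "length ks = length xs" "set xs \<subseteq> carrier (edge_ring E)"
  shows "list_monomial xs ks \<in> carrier (edge_ring E)"
  using assms by (induction ks xs rule: list_induct2) (auto intro: edge_ring_closed edge_ring_power)

text \<open>An ascending chain of primes beginning at \<open>P\<close>, remembered by one witness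
  for each strict inclusion. The recursive form permits induction on the witnesses.\<close>

fun prime_flag :: "edges \<Rightarrow> 'k::field mpoly set \<Rightarrow> 'k mpoly list \<Rightarrow> bool" where
  "prime_flag E P [] \<longleftrightarrow> primeideal P (edge_ring E)"
| "prime_flag E P (x # xs) \<longleftrightarrow> primeideal P (edge_ring E) \<and> x \<in> carrier (edge_ring E) \<and> x \<notin> P \<and>
    (\<exists>Q. P \<subseteq> Q \<and> x \<in> Q \<and> prime_flag E Q xs)"

lemma prime_flag_carrier: "prime_flag E P xs \<Longrightarrow> set xs \<subseteq> carrier (edge_ring E)"
  by (induction xs arbitrary: P) auto

lemma prime_flag_prime: "prime_flag E P xs \<Longrightarrow> primeideal P (edge_ring E)"
  by (cases xs) auto

context edge_ring_prime
begin

lemma prime_zero: "0 \<in> P"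
proof -
  interpret P: primeideal P "edge_ring E" by (rule prime)
  show ?thesis
    using additive_subgroup.zero_closed[OF P.is_additive_subgroup] by (simp add: edge_ring_simps)
qed

lemma prime_power:
  "p \<in> carrier (edge_ring E) \<Longrightarrow> q \<in> carrier (edge_ring E) \<Longrightarrow> p ^ k * q \<in> P \<Longrightarrow> p \<notin> P \<Longrightarrow>
    q \<in> P"
proof (induction k)
  case (Suc k)
  then have "p * (p ^ k * q) \<in> P" by (simp add: mult.assoc)
  then show ?case using prime_dvd[of p "p ^ k * q"] Suc edge_ring_closed(2) edge_ring_power by blast
qed simp

end

text \<open>The term of lowest order in \<open>x\<^sub>1\<close>, divided by the power of \<open>x\<^sub>1\<close>, lies in the second prime of
  the flag because the rest is divisible by \<open>x\<^sub>1\<close>.\<close>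

lemma prime_flag_independent:
  fixes xs :: "'k::field mpoly list" and c :: "nat list \<Rightarrow> 'k"
  assumes "prime_flag E P xs" "finite I" "\<And>ks. ks \<in> I \<Longrightarrow> length ks = length xs"
    "(\<Sum>ks\<in>I. mpoly_const (c ks) * list_monomial xs ks) \<in> P" "ks \<in> I"
  shows "c ks = 0"
  using assms
proof (induction xs arbitrary: P I c ks)
  case Nil
  interpret edge_ring_prime E P using Nil by (simp add: edge_ring_prime_def)
  have "I = {[]}" "ks = []" using Nil by auto
  then have "mpoly_const (c []) \<in> P" using Nil(4) by simp
  show ?case
  proof (rule ccontr)
    assume "c ks \<noteq> 0"
    then have "mpoly_const (inverse (c [])) * mpoly_const (c []) = 1"
      using \<open>ks = []\<close> by (simp add: mpoly_const_def mult_single)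
    then show False
      using prime_mult[OF \<open>mpoly_const (c []) \<in> P\<close> mpoly_const_in_edge_ring] one_notin_prime by metis
  qed
next
  case (Cons x xs)
  interpret edge_ring_prime E P using Cons(2) by (simp add: edge_ring_prime_def)
  obtain Q where Q: "P \<subseteq> Q" "x \<in> Q" "prime_flag E Q xs" and x: "x \<in> carrier (edge_ring E)" "x \<notin> P"
    using Cons(2) by auto
  interpret Q: edge_ring_prime E Q using prime_flag_prime[OF Q(3)] by (simp add: edge_ring_prime_def)
  have len: "length (tl ks) = length xs \<and> ks = hd ks # tl ks" if "ks \<in> I" for ks
    using Cons(4)[OF that] by (cases ks) auto
  define R :: "'k mpoly set" where "R = carrier (edge_ring E)"
  have xsR: "set xs \<subseteq> R" using prime_flag_carrier[OF Q(3)] by (simp add: R_def)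
  show ?case
  proof (rule ccontr)
    assume "c ks \<noteq> 0"
    define J where "J = {ks \<in> I. c ks \<noteq> 0}"
    have J: "finite J" "ks \<in> J" "J \<subseteq> I" using Cons(3,6) \<open>c ks \<noteq> 0\<close> by (auto simp: J_def)
    define a where "a = Min (hd ` J)"
    have a: "a \<le> hd ks" if "ks \<in> J" for ks using that J(1) by (simp add: a_def)
    have "a \<in> hd ` J" unfolding a_def using J by (intro Min_in) auto
    then obtain ks0 where ks0: "ks0 \<in> J" "hd ks0 = a" by auto
    define t where "t ks = mpoly_const (c ks) * list_monomial xs (tl ks)" for ks
    have tR: "t ks \<in> R" if "ks \<in> J" for ks
      unfolding t_def R_def using len[of ks] that J(3) xsR
      by (intro edge_ring_closed mpoly_const_in_edge_ring edge_ring_list_monomial) (auto simp: R_def)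
    define J0 where "J0 = {ks \<in> J. hd ks = a}"
    define J1 where "J1 = {ks \<in> J. hd ks \<noteq> a}"
    have fin: "finite J0" "finite J1" and JJ: "J = J0 \<union> J1" "J0 \<inter> J1 = {}"
      using J(1) by (auto simp: J0_def J1_def)
    \<comment> \<open>The relation becomes \<open>x ^ a * (Z + x * Y)\<close>. On \<open>J1\<close>
      the exponent of \<open>x\<close> exceeds \<open>a\<close>, so the truncated subtraction of
      \<open>Suc a\<close> is a true difference.\<close>
    define Y where "Y = (\<Sum>ks\<in>J1. x ^ (hd ks - Suc a) * t ks)"
    define Z where "Z = (\<Sum>ks\<in>J0. t ks)"
    have YR: "Y \<in> R" and ZR: "Z \<in> R" unfolding Y_def Z_def R_def
      using tR x(1) JJ(1) by (auto intro!: edge_ring_sum edge_ring_closed edge_ring_power simp: R_def)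
    have summand: "mpoly_const (c ks) * list_monomial (x # xs) ks = x ^ hd ks * t ks" if "ks \<in> J" for ks
    proof -
      have "list_monomial (x # xs) ks = x ^ hd ks * list_monomial xs (tl ks)"
      proof -
        have "ks \<in> I" using that J(3) by blast
        then have "hd ks # tl ks = ks" using len[of ks] by simp
        then show ?thesis using list_monomial_Cons[of x xs "hd ks" "tl ks"] by (simp only:)
      qed
      then show ?thesis by (simp add: t_def mult.left_commute)
    qed
    have "(\<Sum>ks\<in>I. mpoly_const (c ks) * list_monomial (x # xs) ks) = (\<Sum>ks\<in>J. x ^ hd ks * t ks)"
      using Cons(3) summand by (intro sum.mono_neutral_cong_right) (auto simp: J_def mpoly_const_def)
    also have "\<dots> = (\<Sum>ks\<in>J0. x ^ hd ks * t ks) + (\<Sum>ks\<in>J1. x ^ hd ks * t ks)"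
      unfolding JJ(1) by (rule sum.union_disjoint[OF fin JJ(2)])
    also have "(\<Sum>ks\<in>J0. x ^ hd ks * t ks) = x ^ a * Z"
      unfolding Z_def sum_distrib_left by (intro sum.cong) (auto simp: J0_def)
    also have "(\<Sum>ks\<in>J1. x ^ hd ks * t ks) = x ^ a * (x * Y)"
      unfolding Y_def sum_distrib_left
    proof (intro sum.cong refl)
      fix ks assume "ks \<in> J1"
      then have "a < hd ks" using a[of ks] by (auto simp: J1_def)
      then have "hd ks = a + Suc (hd ks - Suc a)" by simp
      then have "x ^ hd ks = x ^ a * (x * x ^ (hd ks - Suc a))"
        by (metis power_Suc power_add)
      then show "x ^ hd ks * t ks = x ^ a * (x * (x ^ (hd ks - Suc a) * t ks))"
        by (simp add: mult.assoc)
    qed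
    finally have "x ^ a * (Z + x * Y) \<in> P" using Cons(5) by (simp add: distrib_left)
    moreover have "Z + x * Y \<in> carrier (edge_ring E)"
      using x(1) YR ZR unfolding R_def by (intro edge_ring_closed(1,2))
    ultimately have "Z + x * Y \<in> P" using prime_power[OF x(1) _ _ x(2)] by blast
    then have "Z + x * Y \<in> Q" using Q(1) by blast
    moreover have "- Y * x \<in> Q"
      by (rule Q.prime_mult[OF Q(2)]) (use YR in \<open>simp add: R_def edge_ring_closed\<close>)
    ultimately have "Z + x * Y + - Y * x \<in> Q" by (rule Q.prime_add)
    then have ZQ: "Z \<in> Q" by (simp add: mult.commute)
    have tl: "inj_on tl J0"
      using len J(3) by (intro inj_onI) (metis (mono_tags, lifting) J0_def mem_Collect_eq subsetD)
    have tlJ: "a # tl ks = ks" if "ks \<in> J0" for ks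
      using len[of ks] that J(3) by (auto simp: J0_def)
    have "(\<Sum>ls\<in>tl ` J0. mpoly_const (c (a # ls)) * list_monomial xs ls) = Z"
      unfolding Z_def by (subst sum.reindex[OF tl]) (auto simp: t_def tlJ intro!: sum.cong)
    then have "(\<Sum>ls\<in>tl ` J0. mpoly_const (c (a # ls)) * list_monomial xs ls) \<in> Q" using ZQ by simp
    moreover have ks0J: "ks0 \<in> J0" using ks0 by (simp add: J0_def)
    moreover have "length ls = length xs" if "ls \<in> tl ` J0" for ls
      using that len J(3) by (auto simp: J0_def)
    ultimately have "c (a # tl ks0) = 0"
      using Cons(1)[of Q "tl ` J0" "\<lambda>ls. c (a # ls)" "tl ks0"] Q(3) fin(1) by blast
    then show False using tlJ[OF ks0J] ks0(1) by (simp add: J_def)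
  qed
qed

lemma keys_mult_upto:
  fixes p q :: "'k::field mpoly"
  assumes "Poly_Mapping.keys p \<subseteq> exponents_upto E m" "Poly_Mapping.keys q \<subseteq> exponents_upto E n"
  shows "Poly_Mapping.keys (p * q) \<subseteq> exponents_upto E (m + n)"
proof
  fix k assume "k \<in> Poly_Mapping.keys (p * q)"
  then obtain a b where "k = a + b" "a \<in> Poly_Mapping.keys p" "b \<in> Poly_Mapping.keys q"
    using keys_mult[of p q] by blast
  then show "k \<in> exponents_upto E (m + n)" using exponents_upto_add[of a E m b n] assms by blast
qed

lemma zero_exponents_upto: "0 \<in> exponents_upto E n"
  using edge_exponents_zero by (auto simp: exponents_upto_def)

lemma keys_power_upto:
  fixes p :: "'k::field mpoly"
  assumes "Poly_Mapping.keys p \<subseteq> exponents_upto E c"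
  shows "Poly_Mapping.keys (p ^ k) \<subseteq> exponents_upto E (c * k)"
proof (induction k)
  case 0
  then show ?case using zero_exponents_upto by auto
next
  case (Suc k)
  then show ?case using keys_mult_upto[OF assms Suc] by simp
qed

lemma keys_list_monomial_upto:
  fixes xs :: "'k::field mpoly list"
  assumes "length ks = length xs" "\<forall>x\<in>set xs. Poly_Mapping.keys x \<subseteq> exponents_upto E c"
    "\<forall>k\<in>set ks. k \<le> M"
  shows "Poly_Mapping.keys (list_monomial xs ks) \<subseteq> exponents_upto E (c * M * length xs)"
  using assms
proof (induction ks xs rule: list_induct2)
  case Nil
  then show ?case using zero_exponents_upto by auto
next
  case (Cons k ks x xs)
  have "c * k \<le> c * M" using Cons(4) by simp
  then have "Poly_Mapping.keys (x ^ k) \<subseteq> exponents_upto E (c * M)"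
    using keys_power_upto[of x E c k] Cons(3) exponents_upto_mono[of "c * k" "c * M" E] by auto
  then show ?case using keys_mult_upto[of "x ^ k" E "c * M" "list_monomial xs ks"] Cons by simp
qed

lemma finite_subset_exponents_upto:
  assumes "finite K" "K \<subseteq> (\<Union>n. edge_exponents E n)"
  shows "\<exists>c. K \<subseteq> exponents_upto E c"
  using assms
proof induction
  case (insert m K)
  then obtain n c where "m \<in> edge_exponents E n" "K \<subseteq> exponents_upto E c" by auto
  then have "insert m K \<subseteq> exponents_upto E (max n c)"
    using exponents_upto_mono[of c "max n c" E] by (auto simp: exponents_upto_def)
  then show ?case by blast
qed simp

text \<open>The monomials in the elements of a flag are too many if the flag is longer than the growth rate
  of the Hilbert function permits.\<close>

lemma prime_flag_length:
  fixes xs :: "'k::field mpoly list"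
  assumes E: "finite E" and K: "\<And>N. card (exponents_upto E N) \<le> K * (N + 1) ^ D"
    and flag: "prime_flag E P xs"
  shows "length xs \<le> D"
proof (rule ccontr)
  assume n: "\<not> length xs \<le> D"
  let ?n = "length xs"
  interpret edge_ring_prime E P using prime_flag_prime[OF flag] by (simp add: edge_ring_prime_def)
  have "\<exists>c. (\<Union>x\<in>set xs. Poly_Mapping.keys x) \<subseteq> exponents_upto E c"
    by (rule finite_subset_exponents_upto)
      (use prime_flag_carrier[OF flag] in \<open>auto simp: carrier_edge_ring\<close>)
  then obtain c where c: "\<forall>x\<in>set xs. Poly_Mapping.keys x \<subseteq> exponents_upto E c" by blast
  \<comment> \<open>The exponent vectors with entries at most \<open>M\<close> give this many
    independent monomials, all supported in filtration degree at most
    \<open>c * M * ?n\<close>.\<close>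
  have bound: "(M + 1) ^ ?n \<le> card (exponents_upto E (c * M * ?n))" for M
  proof -
    define I where "I = {ks. set ks \<subseteq> {0..M} \<and> length ks = ?n}"
    have finI: "finite I" unfolding I_def by (rule finite_lists_length_eq) simp
    have cardI: "card I = (M + 1) ^ ?n" unfolding I_def by (subst card_lists_length_eq) auto
    have zero: "u ks = 0" if "(\<Sum>ks\<in>I. mpoly_const (u ks) * list_monomial xs ks) = 0" "ks \<in> I" for u ks
      using prime_flag_independent[OF flag finI, of u ks] that prime_zero by (auto simp: I_def)
    have inj: "inj_on (list_monomial xs) I"
    proof (rule inj_onI, rule ccontr)
      fix ks ls assume kl: "ks \<in> I" "ls \<in> I" "list_monomial xs ks = list_monomial xs ls" "ks \<noteq> ls"
      \<comment> \<open>Two equal monomials with different exponent vectors would satisfy a relation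
        with coefficients 1 and -1.\<close>
      define u :: "nat list \<Rightarrow> 'k" where "u = (\<lambda>j. if j = ks then 1 else if j = ls then -1 else 0)"
      have "(\<Sum>j\<in>I. mpoly_const (u j) * list_monomial xs j) = (\<Sum>j\<in>{ks, ls}. mpoly_const (u j) *
        list_monomial xs j)"
        using kl finI by (intro sum.mono_neutral_right) (auto simp: u_def mpoly_const_def)
      also have "\<dots> = 0" using kl(3,4) by (simp add: u_def mpoly_const_def single_uminus)
      finally have "u ks = 0" using zero[of u ks] kl(1) by blast
      then show False by (simp add: u_def)
    qed
    have "mpoly.independent (list_monomial xs ` I)"
    proof (rule mpoly.independent_if_scalars_zero)
      fix f v assume sum: "(\<Sum>x\<in>list_monomial xs ` I. mpoly_scale (f x) x) = 0" and v:
        "v \<in> list_monomial xs ` I"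
      obtain ks where ks: "ks \<in> I" "v = list_monomial xs ks" using v by blast
      have "(\<Sum>ks\<in>I. mpoly_const (f (list_monomial xs ks)) * list_monomial xs ks) = 0"
        using sum by (simp add: sum.reindex[OF inj] mpoly_scale_def)
      then show "f v = 0" using zero[of "\<lambda>ks. f (list_monomial xs ks)" ks] ks by simp
    qed (use finI in simp)
    moreover have finS: "finite (exponents_upto E (c * M * ?n))"
      using finite_edge_exponents[OF E] by (simp add: exponents_upto_def)
    moreover have "list_monomial xs ` I \<subseteq>
        mpoly.span ((\<lambda>m. Poly_Mapping.single m 1) ` exponents_upto E (c * M * ?n))"
    proof -
      have "Poly_Mapping.keys (list_monomial xs ks) \<subseteq> exponents_upto E (c * M * ?n)" if "ks \<in> I" for ks
        using that c by (intro keys_list_monomial_upto) (auto simp: I_def subset_iff)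
      then show ?thesis unfolding span_monomials by blast
    qed
    ultimately have "card (list_monomial xs ` I) \<le>
        card ((\<lambda>m. Poly_Mapping.single m (1::'k)) ` exponents_upto E (c * M * ?n))"
      by (intro mpoly.independent_span_bound[THEN conjunct2]) simp_all
    also have "\<dots> \<le> card (exponents_upto E (c * M * ?n))" by (rule card_image_le[OF finS])
    finally show ?thesis using card_image[OF inj] cardI by simp
  qed
  \<comment> \<open>Chosen so that \<open>c * M * ?n + 1\<close> is at most
    \<open>c' * (M + 1)\<close>. The growth bound then becomes \<open>M * (M + 1) ^ D\<close>, too
    small for the \<open>(M + 1) ^ (D + 1)\<close> monomials.\<close>
  define c' where "c' = c * ?n + 1"
  define M where "M = K * c' ^ D"
  have "(M + 1) * (M + 1) ^ D \<le> (M + 1) ^ ?n"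
    using n power_increasing[of "Suc D" ?n "M + 1"] by simp
  also have "\<dots> \<le> K * (c * M * ?n + 1) ^ D" using bound[of M] K[of "c * M * ?n"] by linarith
  also have "\<dots> \<le> K * (c' * (M + 1)) ^ D"
    by (intro mult_le_mono power_mono) (auto simp: c'_def algebra_simps)
  also have "\<dots> = M * (M + 1) ^ D" by (simp only: M_def power_mult_distrib mult.assoc)
  finally show False by simp
qed

lemma prime_chain_flag:
  fixes P :: "nat \<Rightarrow> 'k::field mpoly set"
  assumes "\<forall>i\<le>n. primeideal (P i) (edge_ring E)" "\<forall>i<n. P i \<subset> P (Suc i)"
  shows "\<exists>xs. length xs = n \<and> prime_flag E (P 0) xs"
  using assms
proof (induction n arbitrary: P)
  case 0
  then show ?case by (intro exI[of _ "[]"]) simp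
next
  case (Suc n)
  have "\<exists>xs. length xs = n \<and> prime_flag E (P (Suc 0)) xs"
    using Suc.IH[of "\<lambda>i. P (Suc i)"] Suc.prems by simp
  then obtain xs where xs: "length xs = n" "prime_flag E (P (Suc 0)) xs" by blast
  have "P 0 \<subset> P (Suc 0)" using Suc.prems(2) by simp
  then obtain x where x: "x \<in> P (Suc 0)" "x \<notin> P 0" "P 0 \<subseteq> P (Suc 0)" by blast
  have "P (Suc 0) \<subseteq> carrier (edge_ring E)"
    using Suc.prems(1) by (intro edge_ring_prime.prime_subset edge_ring_prime.intro) simp
  then have "prime_flag E (P 0) (x # xs)" using x xs Suc.prems(1) by auto
  then show ?case using xs(1) by (intro exI[of _ "x # xs"]) simp
qed

text \<open>Dividing by \<open>1 - fps_X\<close> forms partial sums, so each factor raises the order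
  of growth by at most one.\<close>

lemma fps_growth:
  fixes F :: "int fps"
  assumes "\<And>n. \<bar>fps_nth (F * (1 - fps_X) ^ D) n\<bar> \<le> K"
  shows "\<bar>fps_nth F n\<bar> \<le> K * (int n + 1) ^ D"
  using assms
proof (induction D arbitrary: F n)
  case (Suc D)
  have K: "0 \<le> K" using Suc.prems[of 0] by linarith
  have IH: "\<bar>fps_nth (F * (1 - fps_X)) n\<bar> \<le> K * (int n + 1) ^ D" for n
    by (rule Suc.IH) (use Suc.prems in \<open>simp add: mult.assoc\<close>)
  show ?case
  proof (induction n)
    case 0
    then show ?case using IH[of 0] by (simp add: fps_nth_mult_one_minus_X)
  next
    case (Suc n)
    have "\<bar>fps_nth F (Suc n)\<bar> \<le> \<bar>fps_nth F n\<bar> + \<bar>fps_nth (F * (1 - fps_X)) (Suc n)\<bar>"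
      unfolding fps_nth_mult_one_minus_X by simp
    also have "\<dots> \<le> K * (int n + 1) ^ Suc D + K * (int n + 2) ^ D" using Suc IH[of "Suc n"]
      by (simp add: add.commute)
    also have "K * (int n + 1) ^ Suc D \<le> K * ((int n + 1) * (int n + 2) ^ D)"
      using K by (auto intro!: mult_left_mono power_mono)
    finally show ?case by (simp add: algebra_simps)
  qed
qed simp

text \<open>Partial sums of \<open>F\<close> would seem to cost one more factor of growth. Cleared
  of the denominator, however, they become partial sums of the coefficients of \<open>h\<close>,
  which are bounded, so the exponent remains \<open>D\<close>.\<close>

lemma fps_partial_sum_growth:
  fixes F :: "int fps"
  assumes "F * (1 - fps_X) ^ D = fps_of_poly h"
  obtains K :: nat where "\<And>N. (\<Sum>n\<le>N. fps_nth F n) \<le> int K * (int N + 1) ^ D"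
proof -
  let ?one = "Abs_fps (\<lambda>_. 1) :: int fps"
  have ps: "fps_nth (G * ?one) n = (\<Sum>i\<le>n. fps_nth G i)" for G n
    by (simp add: fps_mult_nth atMost_atLeast0)
  define K where "K = (\<Sum>i\<le>degree h. \<bar>coeff h i\<bar>)"
  have "\<bar>fps_nth (F * ?one * (1 - fps_X) ^ D) n\<bar> \<le> K" for n
  proof -
    have "F * ?one * (1 - fps_X) ^ D = F * (1 - fps_X) ^ D * ?one"
      by (simp only: mult_ac)
    also have "\<dots> = fps_of_poly h * ?one" by (simp only: assms)
    finally have "F * ?one * (1 - fps_X) ^ D = fps_of_poly h * ?one" .
    then have "\<bar>fps_nth (F * ?one * (1 - fps_X) ^ D) n\<bar> = \<bar>\<Sum>i\<le>n. coeff h i\<bar>"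
      by (simp only: ps fps_of_poly_nth)
    also have "\<dots> \<le> (\<Sum>i\<le>n. \<bar>coeff h i\<bar>)" by (rule sum_abs)
    also have "\<dots> \<le> (\<Sum>i\<in>{..n} \<union> {..degree h}. \<bar>coeff h i\<bar>)" by (intro sum_mono2) auto
    also have "\<dots> = K" unfolding K_def by (intro sum.mono_neutral_right) (auto simp: coeff_eq_0)
    finally show ?thesis .
  qed
  from fps_growth[OF this] have "\<bar>\<Sum>i\<le>N. fps_nth F i\<bar> \<le> K * (int N + 1) ^ D" for N
    by (simp add: ps)
  moreover have "0 \<le> K" by (simp add: K_def sum_nonneg)
  ultimately show thesis using that[of "nat K"] by (metis abs_ge_self int_nat_eq order_trans)
qed

section \<open>Lower bound by kernels of monomial maps\<close>

text \<open>The linear map of monoid algebras induced by \<open>f\<close> on exponents; it is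
  multiplicative when \<open>f\<close> is additive.\<close>

definition push :: "('a \<Rightarrow> 'b) \<Rightarrow> ('a \<Rightarrow>\<^sub>0 'k::comm_monoid_add) \<Rightarrow> ('b \<Rightarrow>\<^sub>0 'k)" where
  "push f p = (\<Sum>m\<in>Poly_Mapping.keys p. Poly_Mapping.single (f m) (Poly_Mapping.lookup p m))"

lemma push_superset:
  "finite K \<Longrightarrow> Poly_Mapping.keys p \<subseteq> K \<Longrightarrow> push f p = (\<Sum>m\<in>K. Poly_Mapping.single (f m)
    (Poly_Mapping.lookup p m))"
  unfolding push_def by (intro sum.mono_neutral_left) (auto simp: not_in_keys_iff_lookup_eq_zero)

lemma push_add: "push f (p + q) = push f p + push f q"
proof -
  let ?K = "Poly_Mapping.keys p \<union> Poly_Mapping.keys q"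
  have K: "finite ?K" "Poly_Mapping.keys p \<subseteq> ?K" "Poly_Mapping.keys q \<subseteq> ?K" "Poly_Mapping.keys (p + q)
    \<subseteq> ?K"
    using keys_add[of p q] by auto
  show ?thesis
    by (simp add: push_superset[OF K(1,2)] push_superset[OF K(1,3)] push_superset[OF K(1,4)]
      lookup_add single_add sum.distrib)
qed

lemma push_zero [simp]: "push f 0 = 0" by (simp add: push_def)

lemma push_sum: "push f (\<Sum>i\<in>I. p i) = (\<Sum>i\<in>I. push f (p i))"
  by (induction I rule: infinite_finite_induct) (auto simp: push_add)

lemma push_single [simp]: "push f (Poly_Mapping.single m c) = Poly_Mapping.single (f m) c"
  by (cases "c = 0") (simp_all add: push_def)

lemma push_push: "push g (push f p) = push (\<lambda>m. g (f m)) p"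
  unfolding push_def[of f p] push_sum push_single by (simp only: push_def)

lemma push_uminus: "push f (- p) = - push f (p :: 'a \<Rightarrow>\<^sub>0 'k::ab_group_add)"
  using push_add[of f p "- p"] by (simp add: eq_neg_iff_add_eq_0 add.commute)

lemma push_mult:
  fixes p q :: "'a::comm_monoid_add \<Rightarrow>\<^sub>0 'k::comm_semiring_1" and f :: "'a \<Rightarrow> 'b::comm_monoid_add"
  assumes f: "\<And>a b. f (a + b) = f a + f b"
  shows "push f (p * q) = push f p * push f q"
proof -
  let ?P = "Poly_Mapping.keys p" and ?Q = "Poly_Mapping.keys q"
  have "p * q = (\<Sum>m\<in>?P. Poly_Mapping.single m (Poly_Mapping.lookup p m)) * (\<Sum>n\<in>?Q. Poly_Mapping.single
    n (Poly_Mapping.lookup q n))"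
    using poly_mapping_sum_singles[of ?P p] poly_mapping_sum_singles[of ?Q q] by simp
  also have "\<dots> = (\<Sum>m\<in>?P. \<Sum>n\<in>?Q. Poly_Mapping.single (m + n) (Poly_Mapping.lookup p m *
    Poly_Mapping.lookup q n))"
    by (simp add: sum_product mult_single)
  finally have "push f (p * q) = (\<Sum>m\<in>?P. \<Sum>n\<in>?Q. Poly_Mapping.single (f m + f n) (Poly_Mapping.lookup p
    m * Poly_Mapping.lookup q n))"
    by (simp add: push_sum f)
  also have "\<dots> = push f p * push f q" by (simp add: push_def sum_product mult_single)
  finally show ?thesis .
qed

text \<open>The monoid algebra of a linearly ordered cancellative monoid has no zero divisors, so
  the kernel of a homomorphism into it is prime.\<close>

lemma primeideal_push_kernel:
  fixes f :: "(nat \<Rightarrow>\<^sub>0 nat) \<Rightarrow> 'b::{ordered_cancel_comm_monoid_add, linorder}"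
  assumes f: "\<And>a b. f (a + b) = f a + f b" "f 0 = 0"
  shows "primeideal {p \<in> carrier (edge_ring E). push f p = 0} (edge_ring E :: 'k::field mpoly ring)"
proof -
  let ?R = "edge_ring E :: 'k mpoly ring"
  let ?P = "{p \<in> carrier ?R. push f p = 0}"
  interpret R: cring ?R by (rule cring_edge_ring)
  have minus: "\<ominus>\<^bsub>?R\<^esub> p = - p" if "p \<in> carrier ?R" for p
    using R.minus_equality[of "- p" p] that by (simp add: edge_ring_simps edge_ring_closed)
  have "subgroup ?P (add_monoid ?R)"
  proof (rule R.add.subgroupI)
    show "?P \<noteq> {}" using edge_ring_closed(4)[of E] by force
    show "\<ominus>\<^bsub>?R\<^esub> p \<in> ?P" if "p \<in> ?P" for p
      using that minus[of p] edge_ring_closed(5)[of p E] by (simp add: push_uminus)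
    show "p \<oplus>\<^bsub>?R\<^esub> q \<in> ?P" if "p \<in> ?P" "q \<in> ?P" for p q
      using that edge_ring_closed(1)[of p E q] by (simp add: edge_ring_simps push_add)
  qed auto
  then have "additive_subgroup ?P ?R" by (rule additive_subgroup.intro)
  then show ?thesis
  proof (rule primeidealI2[OF _ cring_edge_ring])
    have "push f (1 :: 'k mpoly) \<noteq> 0"
      unfolding single_one[symmetric] push_single
        by (metis keys_single keys_zero insert_not_empty zero_neq_one)
    then show "carrier ?R \<noteq> ?P" using edge_ring_closed(3)[of E] by blast
    show "p \<in> ?P \<or> q \<in> ?P" if "p \<in> carrier ?R" "q \<in> carrier ?R" "p \<otimes>\<^bsub>?R\<^esub> q \<in> ?P" for p q
      using that by (simp add: edge_ring_simps push_mult[of f, OF f(1)])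
  qed (auto simp: edge_ring_simps push_mult[of f, OF f(1)] edge_ring_closed)
qed

text \<open>Given independent vectors \<open>v e\<close>, take the coordinate functions \<open>g e\<close> dual to them; forgetting
  the first \<open>j\<close> coordinates of the exponents gives the \<open>j\<close>-th prime.\<close>

lemma ex_prime_chain:
  fixes v :: "(nat \<Rightarrow>\<^sub>0 nat) \<Rightarrow> 'v::real_vector"
  assumes v: "\<And>a b. v (a + b) = v a + v b"
    and es: "distinct es" "set es \<subseteq> E" "inj_on (\<lambda>e. v (edge_exponent e)) (set es)"
      "independent ((\<lambda>e. v (edge_exponent e)) ` set es)"
  shows "\<exists>P :: nat \<Rightarrow> 'k::field mpoly set. (\<forall>i\<le>length es. primeideal (P i) (edge_ring E)) \<and>
    (\<forall>i<length es. P i \<subset> P (Suc i))"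
proof -
  let ?D = "length es"
  define b where "b j = v (edge_exponent (es ! j))" for j
  have binj: "b i = b j \<longleftrightarrow> i = j" if "i < ?D" "j < ?D" for i j
    using inj_on_eq_iff[OF es(3), of "es ! i" "es ! j"] nth_eq_iff_index_eq[OF es(1) that] that
    by (simp add: b_def)
  have "\<exists>g. linear g \<and> (\<forall>i<?D. g (b i) = (if i = j then 1 else 0 :: real))" if "j < ?D" for j
  proof -
    obtain g where g: "linear g" "\<forall>x\<in>(\<lambda>e. v (edge_exponent e)) ` set es. g x = (if x =
      b j then 1 else 0 :: real)"
      using linear_independent_extend[OF es(4), of "\<lambda>x. if x = b j then 1 else 0 :: real"]
        by (elim exE conjE) rule
    have "g (b i) = (if i = j then 1 else 0)" if "i < ?D" for i
      using g(2) binj[OF that \<open>j < ?D\<close>] that by (auto simp: b_def)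
    then show ?thesis using g(1) by blast
  qed
  then obtain g where g: "\<And>j. j < ?D \<Longrightarrow> linear (g j)"
    "\<And>i j. j < ?D \<Longrightarrow> i < ?D \<Longrightarrow> g j (b i) = (if i = j then 1 else 0 :: real)"
    by metis
  \<comment> \<open>The remaining coordinates are stored as a finitely supported function because
    that type is a linearly ordered cancellative monoid, as \<open>primeideal_push_kernel\<close>
    requires.\<close>
  define \<pi> :: "nat \<Rightarrow> (nat \<Rightarrow>\<^sub>0 nat) \<Rightarrow> (nat \<Rightarrow>\<^sub>0 real)"
    where "\<pi> j m = (\<Sum>k\<in>{j..<?D}. Poly_Mapping.single k (g k (v m)))" for j m
  \<comment> \<open>Since \<open>\<pi> (Suc j)\<close> factors through \<open>\<pi> j\<close> by way
    of this map, the kernels increase.\<close>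
  define \<rho> :: "nat \<Rightarrow> (nat \<Rightarrow>\<^sub>0 real) \<Rightarrow> (nat \<Rightarrow>\<^sub>0 real)"
    where "\<rho> j x = (\<Sum>k\<in>{j..<?D}. Poly_Mapping.single k (Poly_Mapping.lookup x k))" for j x
  have v0: "v 0 = 0" using v[of 0 0] by simp
  have \<pi>_add: "\<pi> j (m + n) = \<pi> j m + \<pi> j n" for j m n
    unfolding \<pi>_def sum.distrib[symmetric]
    by (intro sum.cong refl) (simp add: v linear_add[OF g(1)] single_add)
  have \<pi>_0: "\<pi> j 0 = 0" for j using \<pi>_add[of j 0 0] by simp
  have lookup\<pi>: "Poly_Mapping.lookup (\<pi> j m) k = (if k \<in> {j..<?D} then g k (v m) else 0)" for j m k
    by (simp add: \<pi>_def lookup_sum lookup_single when_def)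
  have \<rho>: "\<rho> (Suc j) (\<pi> j m) = \<pi> (Suc j) m" for j m
    unfolding \<rho>_def \<pi>_def[of "Suc j"] by (intro sum.cong refl) (simp add: lookup\<pi>)
  define P :: "nat \<Rightarrow> 'k mpoly set" where "P j = {p \<in> carrier (edge_ring E). push (\<pi> j) p = 0}" for j
  have "primeideal (P j) (edge_ring E)" for j
    unfolding P_def by (rule primeideal_push_kernel) (simp_all add: \<pi>_add \<pi>_0)
  moreover have "P j \<subset> P (Suc j)" if j: "j < ?D" for j
  proof
    show "P j \<subseteq> P (Suc j)"
    proof
      fix p assume "p \<in> P j"
      then show "p \<in> P (Suc j)"
        using push_push[of "\<rho> (Suc j)" "\<pi> j" p] by (simp add: P_def \<rho>)
    qed
    let ?m = "edge_exponent (es ! j)"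
    \<comment> \<open>The edge monomial minus 1 separates the two primes: its exponent is nonzero
      only in coordinate \<open>j\<close>, which \<open>\<pi> j\<close> keeps and
      \<open>\<pi> (Suc j)\<close> forgets.\<close>
    let ?p = "Poly_Mapping.single ?m 1 + - 1 :: 'k mpoly"
    have "es ! j \<in> E" using es(2) j by auto
    then have "?m \<in> (\<Union>n. edge_exponents E n)" using edge_exponents_one by blast
    then have "Poly_Mapping.single ?m 1 \<in> carrier (edge_ring E :: 'k mpoly ring)"
      by (simp add: carrier_edge_ring)
    then have p: "?p \<in> carrier (edge_ring E)"
      by (intro edge_ring_closed(1) edge_ring_closed(5) edge_ring_closed(3))
    have push: "push (\<pi> i) ?p = Poly_Mapping.single (\<pi> i ?m) 1 - Poly_Mapping.single 0 1" for i
      unfolding push_add push_uminus single_one[symmetric] push_single \<pi>_0 by simp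
    have gm: "g k (v ?m) = (if j = k then 1 else 0)" if "k < ?D" for k
      using g(2)[OF that j] by (simp add: b_def)
    have "\<pi> (Suc j) ?m = 0"
      by (rule poly_mapping_eqI) (simp add: lookup\<pi> gm)
    then have "?p \<in> P (Suc j)" using p push[of "Suc j"] by (simp add: P_def)
    moreover have "\<pi> j ?m \<noteq> 0"
      using lookup\<pi>[of j ?m j] gm[OF j] j by auto
    then have "push (\<pi> j) ?p \<noteq> 0"
      unfolding push by (metis eq_iff_diff_eq_0 keys_single singleton_inject zero_neq_one)
    then have "?p \<notin> P j" by (simp add: P_def)
    ultimately show "P j \<noteq> P (Suc j)" by blast
  qed
  ultimately show ?thesis by blast
qed

text \<open>A basis picked among the edge vectors has as many elements as the exponent of the
  denominator, so the lower bound meets the growth bound.\<close>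

lemma krull_dim_edge_ring:
  fixes v :: "(nat \<Rightarrow>\<^sub>0 nat) \<Rightarrow> 'v::real_vector"
  assumes E: "finite E" and v: "\<And>a b. v (a + b) = v a + v b"
    and inj: "inj_on (\<lambda>e. v (edge_exponent e)) E"
    and h: "Abs_fps (\<lambda>n. int (card (edge_exponents E n))) * (1 - fps_X) ^ dim ((\<lambda>e. v (edge_exponent
      e)) ` E) = fps_of_poly h"
  shows "krull_dim (edge_ring E :: 'k::field mpoly ring) = enat (dim ((\<lambda>e. v (edge_exponent e)) ` E))"
proof -
  let ?A = "(\<lambda>e. v (edge_exponent e)) ` E"
  let ?D = "dim ?A"
  obtain K where K: "\<And>N. (\<Sum>n\<le>N. int (card (edge_exponents E n))) \<le> int K * (int N + 1) ^ ?D"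
    using fps_partial_sum_growth[OF h] by auto
  have "card (exponents_upto E N) \<le> K * (N + 1) ^ ?D" for N
  proof -
    have "card (exponents_upto E N) \<le> (\<Sum>n\<le>N. card (edge_exponents E n))"
      unfolding exponents_upto_def by (rule card_UN_le) simp
    moreover have "int (\<Sum>n\<le>N. card (edge_exponents E n)) \<le> int (K * (N + 1) ^ ?D)" using K[of N]
      by (simp add: add.commute)
    ultimately show ?thesis by linarith
  qed
  then have upper: "n \<le> ?D" if "\<forall>i\<le>n. primeideal (P i) (edge_ring E)" "\<forall>i<n. P i \<subset> P (Suc i)"
    for n and P :: "nat \<Rightarrow> 'k mpoly set"
    using prime_chain_flag[OF that] prime_flag_length[OF E] by blast
  obtain B where B: "B \<subseteq> ?A" "independent B" "?A \<subseteq> span B" "card B = ?D"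
    using basis_exists[of ?A] by blast
  then obtain F where F: "F \<subseteq> E" "B = (\<lambda>e. v (edge_exponent e)) ` F" by (meson subset_image_iff)
  have injF: "inj_on (\<lambda>e. v (edge_exponent e)) F" using inj F(1) inj_on_subset by blast
  obtain es where es: "distinct es" "set es = F"
    using finite_distinct_list[OF finite_subset[OF F(1) E]] by blast
  have len: "length es = ?D"
    using distinct_card[OF es(1)] es(2) card_image[OF injF] F(2) B(4) by simp
  have "\<exists>P :: nat \<Rightarrow> 'k mpoly set. (\<forall>i\<le>?D. primeideal (P i) (edge_ring E)) \<and> (\<forall>i<?D. P i \<subset> P (Suc i))"
    using ex_prime_chain[of v es E] v es F B(2) injF len by simp
  then show ?thesis
    unfolding krull_dim_def using upper by (intro antisym Sup_least Sup_upper) auto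
qed

section \<open>Regular graphs\<close>

definition real_exponent :: "(nat \<Rightarrow>\<^sub>0 nat) \<Rightarrow> (nat \<Rightarrow>\<^sub>0 real)" where
  "real_exponent m = Poly_Mapping.map real m"

lemma lookup_real_exponent: "Poly_Mapping.lookup (real_exponent m) i = real (Poly_Mapping.lookup m i)"
  by (simp add: real_exponent_def Poly_Mapping.map.rep_eq when_def)

lemma real_exponent_add: "real_exponent (a + b) = real_exponent a + real_exponent b"
  by (rule poly_mapping_eqI) (simp add: lookup_real_exponent lookup_add)

lemma inj_real_exponent: "inj real_exponent"
proof (rule injI, rule poly_mapping_eqI)
  fix a b i assume "real_exponent a = real_exponent b"
  then have "Poly_Mapping.lookup (real_exponent a) i = Poly_Mapping.lookup (real_exponent b) i" by simp
  then show "Poly_Mapping.lookup a i = Poly_Mapping.lookup b i" by (simp add: lookup_real_exponent)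
qed

lemma real_exponent_edge: "finite e \<Longrightarrow> real_exponent (edge_exponent e) = edge_vector e"
  by (rule poly_mapping_eqI)
    (simp add: lookup_real_exponent lookup_edge_vector edge_exponent_def lookup_sum lookup_single
      when_def)

lemma real_exponent_edges:
  "\<forall>e\<in>set es. finite e \<Longrightarrow> real_exponent (sum_list (map edge_exponent es)) =
    sum_list (map edge_vector es)"
proof (induction es)
  case Nil
  show ?case by (rule poly_mapping_eqI) (simp add: lookup_real_exponent)
qed (simp add: real_exponent_add real_exponent_edge)

lemma edge_vector_sum_in_fcone:
  assumes "finite E" "set es \<subseteq> E"
  shows "sum_list (map edge_vector es) \<in> fcone (edge_vector ` E)"
  using assms(2)
proof (induction es)
  case Nil
  have "(\<Sum>a\<in>edge_vector ` E. 0 *\<^sub>R a) \<in> fcone (edge_vector ` E)" by (rule fconeI) simp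
  then show ?case by simp
next
  case (Cons e es)
  have "edge_vector e \<in> fcone {edge_vector e}" using fconeI[of "{edge_vector e}" "\<lambda>_. 1"] by simp
  then have "edge_vector e \<in> fcone (edge_vector ` E)"
    using fcone_mono[of "edge_vector ` E" "{edge_vector e}"] assms(1) Cons by auto
  then show ?case using Cons by (simp add: fcone_add)
qed

text \<open>Here normality enters: there are no gaps, so counting lattice points of the cone
  computes the Hilbert function of the ring.\<close>

lemma level_edge_cone:
  assumes G: "graph_on d E" and occ: "odd_cycle_condition E"
  shows "level (half_total d) (even_lattice d \<inter> fcone (edge_vector ` E)) n =
    real_exponent ` edge_exponents E n"
proof -
  have fin: "\<forall>e\<in>set es. finite e" if "set es \<subseteq> E" for es using graph_on_edge[OF G] that by blast
  have total: "half_total d (sum_list (map edge_vector es)) = length es" if "set es \<subseteq> E" for es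
    using that
    by (induction es) (auto simp: linear_0[OF linear_half_total] linear_add[OF linear_half_total]
      half_total_edge[OF G])
  have "even_lattice d \<inter> fcone (edge_vector ` E) = edge_vector_sums E"
    using even_lattice_cone_subset[OF G occ] edge_vector_sums_in_even_lattice[OF G]
      edge_vector_sum_in_fcone[OF graph_on_finite[OF G]] by (auto simp: edge_vector_sums_def)
  then have "level (half_total d) (even_lattice d \<inter> fcone (edge_vector ` E)) n =
      {sum_list (map edge_vector es) | es. set es \<subseteq> E \<and> length es = n}"
    using total by (auto simp: level_def edge_vector_sums_def)
  also have "\<dots> = real_exponent ` edge_exponents E n"
    using real_exponent_edges[OF fin] unfolding edge_exponents_def image_def by force
  finally show ?thesis .
qed

lemma edge_lattice_cone:
  assumes "graph_on d E" "odd_cycle_condition E"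
  shows "lattice_cone (edge_vector ` E) (half_total d) (even_lattice d)"
proof (intro lattice_cone.intro lattice_cone_axioms.intro cone_generators.intro)
  show "finite (edge_vector ` E)" using graph_on_finite[OF assms(1)] by simp
  show "linear (half_total d)" by (rule linear_half_total)
  show "half_total d a = 1" if "a \<in> edge_vector ` E" for a
    using that half_total_edge[OF assms(1)] by auto
  show "x - y \<in> even_lattice d" if "x \<in> even_lattice d" "y \<in> even_lattice d" for x y
    using that by (rule even_lattice_diff)
  show "edge_vector ` E \<subseteq> even_lattice d" using edge_in_even_lattice[OF assms(1)] by auto
  show "0 \<in> even_lattice d" by (simp add: even_lattice_def half_total_def)
  show "finite (level (half_total d) (even_lattice d \<inter> fcone (edge_vector ` E)) n)" for n
    using level_edge_cone[OF assms] finite_edge_exponents[OF graph_on_finite[OF assms(1)]] by simp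
qed

text \<open>The factor \<open>(1 - fps_X) ^ D\<close> has constant term 1, so it preserves the
  lowest term of a series.\<close>

lemma fps_mult_one_minus_X_power_low:
  fixes F :: "'a::comm_ring_1 fps"
  assumes "\<And>n. n < m \<Longrightarrow> fps_nth F n = 0"
  shows "n < m \<Longrightarrow> fps_nth (F * (1 - fps_X) ^ D) n = 0"
    and "fps_nth (F * (1 - fps_X) ^ D) m = fps_nth F m"
proof -
  have "(\<forall>n<m. fps_nth (F * (1 - fps_X) ^ D) n = 0) \<and> fps_nth (F * (1 - fps_X) ^ D) m = fps_nth F m"
  proof (induction D)
    case (Suc D)
    have "F * (1 - fps_X) ^ Suc D = F * (1 - fps_X) ^ D * (1 - fps_X)" by (simp add: mult_ac)
    then show ?case using Suc by (simp only: fps_nth_mult_one_minus_X) auto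
  qed (use assms in simp)
  then show "n < m \<Longrightarrow> fps_nth (F * (1 - fps_X) ^ D) n = 0"
    and "fps_nth (F * (1 - fps_X) ^ D) m = fps_nth F m" by auto
qed

lemma connected_graph_edge:
  assumes "connected_graph d E" "2 \<le> d" "v \<in> {1..d}"
  shows "\<exists>e\<in>E. v \<in> e"
proof -
  define u :: nat where "u = (if v = 1 then 2 else 1)"
  have u: "u \<in> {1..d}" "u \<noteq> v" using assms(2) by (auto simp: u_def)
  then have "(v, u) \<in> {(x, y). {x, y} \<in> E}\<^sup>*" using assms by (auto simp: connected_graph_def)
  then show ?thesis using u(2) by (cases rule: converse_rtranclE) auto
qed

lemma level_open_edge_cone:
  assumes G: "graph_on d E" and conn: "connected_graph d E" and reg: "regular_graph d E"
    and d: "d = 2 * m" "0 < m"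
  defines "X' \<equiv> even_lattice d \<inter> ocone (edge_vector ` E)"
  shows "n < m \<Longrightarrow> level (half_total d) X' n = {}"
    and "level (half_total d) X' m = {\<Sum>i\<in>{1..d}. Poly_Mapping.single i 1}"
proof -
  let ?one = "\<Sum>i\<in>{1..d}. Poly_Mapping.single i (1::real)"
  have finE: "finite E" and E: "\<And>e. e \<in> E \<Longrightarrow> finite e \<and> e \<subseteq> {1..d}"
    using graph_on_finite[OF G] graph_on_edge[OF G] by auto
  have inj: "inj_on edge_vector E" using E edge_vector_inj by (meson inj_onI)
  have vertex: "\<exists>e\<in>E. v \<in> e" if "v \<in> {1..d}" for v
    using connected_graph_edge[OF conn _ that] d by simp
  have lookup: "(\<forall>i\<in>{1..d}. 1 \<le> Poly_Mapping.lookup x i) \<and>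
      (\<forall>i. i \<notin> {1..d} \<longrightarrow> Poly_Mapping.lookup x i = 0)"
    if x: "x \<in> X'" for x
  proof -
    obtain c0 where c0: "\<forall>a\<in>edge_vector ` E. 0 < c0 a" "x = (\<Sum>a\<in>edge_vector ` E. c0 a *\<^sub>R a)"
      using x unfolding X'_def ocone_def by blast
    define c where "c e = c0 (edge_vector e)" for e
    have c: "\<And>e. e \<in> E \<Longrightarrow> 0 < c e" "x = (\<Sum>e\<in>E. c e *\<^sub>R edge_vector e)"
      using c0 inj by (auto simp: c_def sum.reindex)
    have lx: "Poly_Mapping.lookup x i = (\<Sum>e\<in>{e \<in> E. i \<in> e}. c e)" for i
      unfolding c(2) by (rule lookup_edge_combination) (use finE E in auto)
    have "1 \<le> Poly_Mapping.lookup x i" if "i \<in> {1..d}" for i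
    proof -
      have "0 < Poly_Mapping.lookup x i"
        unfolding lx by (rule sum_pos) (use finE vertex[OF that] c(1) in auto)
      moreover have "Poly_Mapping.lookup x i \<in> \<int>" using x by (simp add: X'_def even_lattice_def)
      ultimately show ?thesis by (auto elim!: Ints_cases)
    qed
    moreover have "Poly_Mapping.lookup x i = 0" if "i \<notin> {1..d}" for i
    proof -
      have "{e \<in> E. i \<in> e} = {}" using E that by blast
      then show ?thesis unfolding lx by (simp only: sum.empty)
    qed
    ultimately show ?thesis by blast
  qed
  have ge: "real m \<le> half_total d x" if "x \<in> X'" for x
  proof -
    have "(\<Sum>i\<in>{1..d}. 1::real) \<le> (\<Sum>i\<in>{1..d}. Poly_Mapping.lookup x i)"
      using lookup[OF that] by (intro sum_mono) auto
    then show ?thesis using d by (simp add: half_total_def)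
  qed
  then show "n < m \<Longrightarrow> level (half_total d) X' n = {}"
    by (force simp: level_def)
  have eq: "x = ?one" if x: "x \<in> X'" "half_total d x = real m" for x
  proof (rule poly_mapping_eqI)
    fix i
    have "(\<Sum>i\<in>{1..d}. Poly_Mapping.lookup x i) = 2 * real m" using x(2) by (simp add: half_total_def)
    then have "(\<Sum>i\<in>{1..d}. Poly_Mapping.lookup x i - 1) = 0" using d by (simp add: sum_subtractf)
    then have "\<forall>i\<in>{1..d}. Poly_Mapping.lookup x i - 1 = 0"
      using lookup[OF x(1)] by (subst (asm) sum_nonneg_eq_0_iff) auto
    then show "Poly_Mapping.lookup x i = Poly_Mapping.lookup ?one i"
      using lookup[OF x(1)] by (simp only: lookup_sum_single[OF finite_atLeastAtMost]) auto
  qed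
  have total: "half_total d ?one = real m" using half_total_sum_single[of "{1..d}" d] d by simp
  obtain r where r: "\<And>v. v \<in> {1..d} \<Longrightarrow> card {e \<in> E. v \<in> e} = r"
    using reg by (auto simp: regular_graph_def vertex_degree_def)
  have "{e \<in> E. 1 \<in> e} \<noteq> {}" using vertex[of 1] d by auto
  then have "card {e \<in> E. 1 \<in> e} \<noteq> 0" using finE by simp
  then have "r \<noteq> 0" using r[of 1] d by simp
  \<comment> \<open>Regularity is used here: equal weights \<open>1 / r\<close> on the edges sum to
    1 at each vertex, so the all-ones vector is interior.\<close>
  have "?one = (\<Sum>e\<in>E. (1 / real r) *\<^sub>R edge_vector e)"
  proof (rule poly_mapping_eqI)
    fix i
    have "(\<Sum>e\<in>{e \<in> E. i \<in> e}. 1 / real r) = (if i \<in> {1..d} then 1 else 0)"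
    proof (cases "i \<in> {1..d}")
      case True
      then show ?thesis using r[OF True] \<open>r \<noteq> 0\<close> by simp
    next
      case False
      then have "{e \<in> E. i \<in> e} = {}" using E by blast
      then show ?thesis by (simp only: sum.empty False if_False)
    qed
    then show "Poly_Mapping.lookup ?one i =
        Poly_Mapping.lookup (\<Sum>e\<in>E. (1 / real r) *\<^sub>R edge_vector e) i"
      using lookup_edge_combination[of E "\<lambda>_. 1 / real r" i] finE E
      by (simp only: lookup_sum_single[OF finite_atLeastAtMost])
  qed
  also have "\<dots> = (\<Sum>a\<in>edge_vector ` E. (1 / real r) *\<^sub>R a)" by (simp add: sum.reindex[OF inj])
  also have "\<dots> \<in> ocone (edge_vector ` E)"
    unfolding ocone_def using \<open>r \<noteq> 0\<close> by (intro CollectI exI[of _ "\<lambda>_. 1 / real r"]) simp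
  finally have "?one \<in> ocone (edge_vector ` E)" .
  moreover have "?one \<in> even_lattice d"
    unfolding even_lattice_def using total by (simp add: lookup_sum_single)
  ultimately have "?one \<in> X'" by (simp add: X'_def)
  then show "level (half_total d) X' m = {?one}"
    unfolding level_def using eq total by blast
qed

theorem theorem3p14:
  fixes d :: nat and E :: edges
  assumes "graph_on d E" and "connected_graph d E" and "regular_graph d E"
    and "even d" and "odd_cycle_condition E"
  shows "pseudo_Gorenstein mpoly_scale
    (edge_ring E :: ('k::{alg_closed_field, field_char_0}) mpoly ring)
    (edge_ring_component E)"
proof -
  let ?A = "edge_vector ` E"
  let ?D = "dim ?A"
  obtain m where d: "d = 2 * m" using assms(4) by blast
  have m: "0 < m" using assms(2) d by (simp add: connected_graph_def)
  interpret lattice_cone ?A "half_total d" "even_lattice d"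
    by (rule edge_lattice_cone[OF assms(1,5)])
  obtain h
    where h: "hilbert_fps (half_total d) (even_lattice d \<inter> fcone ?A) * (1 - fps_X) ^ ?D =
      fps_of_poly h"
    and dual: "\<And>n.
      fps_nth (hilbert_fps (half_total d) (even_lattice d \<inter> ocone ?A) * (1 - fps_X) ^ ?D) n =
      (if n \<le> ?D then coeff h (?D - n) else 0)" and deg: "degree h \<le> ?D"
    using hilbert_fps_reciprocity by blast
  have "hilbert_fps (half_total d) (even_lattice d \<inter> fcone ?A) =
    Abs_fps (\<lambda>n. int (card (edge_exponents E n)))"
    unfolding hilbert_fps_def level_edge_cone[OF assms(1,5)]
    by (simp add: card_image inj_on_subset[OF inj_real_exponent])
  then have hs: "Abs_fps (\<lambda>n. int (card (edge_exponents E n))) * (1 - fps_X) ^ ?D = fps_of_poly h"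
    using h by simp
  have A: "(\<lambda>e. real_exponent (edge_exponent e)) ` E = ?A"
    using graph_on_edge[OF assms(1)] by (intro image_cong) (auto simp: real_exponent_edge)
  have "inj_on (\<lambda>e. real_exponent (edge_exponent e)) E"
  proof (rule inj_onI)
    fix e f assume "e \<in> E" "f \<in> E" "real_exponent (edge_exponent e) = real_exponent (edge_exponent f)"
    then show "e = f" using graph_on_edge[OF assms(1)] edge_vector_inj[of e f]
      by (simp add: real_exponent_edge)
  qed
  then have krull: "krull_dim (edge_ring E :: 'k mpoly ring) = enat ?D"
    using krull_dim_edge_ring[of E real_exponent h] graph_on_finite[OF assms(1)] real_exponent_add hs
    unfolding A by blast
  have "is_h_polynomial mpoly_scale (edge_ring E :: 'k mpoly ring) (edge_ring_component E) h"
    unfolding is_h_polynomial_def dim_edge_ring_component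
    using krull hs by (auto simp: mult.commute)
  moreover have "lead_coeff h = 1"
  proof -
    let ?F = "hilbert_fps (half_total d) (even_lattice d \<inter> ocone ?A)"
    note lev = level_open_edge_cone[OF assms(1,2,3) d m]
    have low: "fps_nth ?F n = 0" if "n < m" for n using lev(1)[OF that] by (simp add: hilbert_fps_def)
    have at: "fps_nth ?F m = 1" using lev(2) by (simp add: hilbert_fps_def)
    \<comment> \<open>The value 1 also excludes the default branch 0, and so yields
      \<open>m \<le> ?D\<close>.\<close>
    have "(if m \<le> ?D then coeff h (?D - m) else 0) = 1"
      using fps_mult_one_minus_X_power_low(2)[of m ?F ?D] low at dual[of m] by simp
    then have mD: "m \<le> ?D" and one: "coeff h (?D - m) = 1" by (auto split: if_splits)
    \<comment> \<open>By duality such a coefficient, for \<open>k\<close> up to \<open>?D\<close>,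
      counts in degree \<open>?D - k < m\<close>, below the first interior lattice point.\<close>
    have "coeff h k = 0" if "?D - m < k" for k
    proof (cases "k \<le> ?D")
      case True
      then have "?D - k < m" using that by linarith
      then have "fps_nth (?F * (1 - fps_X) ^ ?D) (?D - k) = 0"
        using fps_mult_one_minus_X_power_low(1)[of m ?F] low by blast
      then show ?thesis using dual[of "?D - k"] True by simp
    next
      case False
      then show ?thesis using deg by (intro coeff_eq_0) linarith
    qed
    then have "degree h \<le> ?D - m" by (intro degree_le) blast
    moreover have "?D - m \<le> degree h" by (rule le_degree) (simp add: one)
    ultimately have "degree h = ?D - m" by simp
    then show ?thesis using one by simp
  qed
  ultimately show ?thesis unfolding pseudo_Gorenstein_def by blast
qed

end
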